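(* Let $d\ge 1$ be an integer, $\alpha\in(0,d)$, and let $r,p$ be real numbers with $\alpha\le r$ and $1<r<p\le d$. Then there is a constant $N$ depending only on $\alpha,d,r,p$ such that the following holds. Let $A$ be a number and let $b\ge 0$ be a measurable function on $\mathbb{R}^d$ such that for any $\rho>0$ and any open ball $B\subset\mathbb{R}^d$ of radius $\rho$ $$ \Big(\frac{1}{|B|}\int_{B}b^{p}\,dx\Big)^{1/p}\le A\rho^{-\alpha}. $$ Then for every $f\in L_r(\mathbb{R}^d)$ $$ \int_{\mathbb{R}^{d}}b^{r}|R_{\alpha}f|^{r}\,dx\le N A^{r}\int_{\mathbb{R}^{d}}|f|^{r}\,dx . $$
   Context: $|B|$ is the Lebesgue measure of $B$. For $\alpha\in(0,d)$ the Riesz potential is $$ R_{\alpha}f(x)=\int_{\mathbb{R}^{d}}\frac{f(x+y)}{|y|^{d-\alpha}}\,dy . $$ *)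

theory Defs
  imports "HOL-Analysis.Analysis"
begin

(* Absolute convergence of the Riesz potential at x.  The integrand at y = 0 is 0 by the
   conventions for powr and division, which does not matter as {0} is a null set. *)
definition riesz_converges :: "real \<Rightarrow> (real^'n \<Rightarrow> real) \<Rightarrow> real^'n \<Rightarrow> bool" where
  "riesz_converges \<alpha> f x \<longleftrightarrow>
     integrable lebesgue (\<lambda>y. f (x + y) / norm y powr (real CARD('n) - \<alpha>))"

(* The Bochner integral is 0 where riesz_converges fails, so statements about
   riesz_potential are to be read together with riesz_converges. *)
definition riesz_potential :: "real \<Rightarrow> (real^'n \<Rightarrow> real) \<Rightarrow> real^'n \<Rightarrow> real" where
  "riesz_potential \<alpha> f x = (LINT y|lebesgue. f (x + y) / norm y powr (real CARD('n) - \<alpha>))"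

(* Functions, not equivalence classes modulo null sets. *)
definition L_fun :: "real \<Rightarrow> (real^'n \<Rightarrow> real) set" where
  "L_fun r = {f \<in> borel_measurable lebesgue. integrable lebesgue (\<lambda>x. \<bar>f x\<bar> powr r)}"

(* Since the right-hand side is finite, the bound includes finiteness of the integral over the
   ball.  This has to be said explicitly, because a divergent Bochner integral is 0. *)
definition morrey_bound :: "real \<Rightarrow> real \<Rightarrow> real \<Rightarrow> (real^'n \<Rightarrow> real) \<Rightarrow> bool" where
  "morrey_bound p \<alpha> A b \<longleftrightarrow>
     (\<forall>\<rho>>0. \<forall>z.
        set_integrable lebesgue (ball z \<rho>) (\<lambda>x. b x powr p) \<and>
        (1 / measure lebesgue (ball z \<rho>) * (LINT x:ball z \<rho>|lebesgue. b x powr p)) powr (1 / p)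
          \<le> A * \<rho> powr (- \<alpha>))"

end

theory Submission
  imports Defs
begin

text \<open>
  Scaling by \<open>A\<close> and replacing functions by Borel versions, one may take \<open>A = 1\<close> and Borel
  \<open>b, f \<ge> 0\<close>.  By Hoelder's inequality and Tonelli (Schur's test), the claim follows from a pair
  of functions \<open>\<phi>, \<psi> > 0\<close> with \<open>R\<^sub>\<alpha> \<phi> \<le> C \<psi>\<close> and
  \<open>R\<^sub>\<alpha> (b\<^sup>r \<psi>\<^sup>r\<^sup>-\<^sup>1) \<le> C \<phi>\<^sup>r\<^sup>-\<^sup>1\<close>.  Both are taken as powers of
  \<open>P = R\<^sub>\<gamma> (b\<^sup>p)\<close> with a small \<open>\<gamma> > 0\<close>, so that maximal functions are not needed: the averages
  of \<open>P\<close> over \<open>B(x,\<rho>)\<close> are bounded by \<open>C P(x)\<close> and by \<open>C \<rho>\<close> to the power \<open>\<gamma> - \<alpha> p\<close>, and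
  those of \<open>b\<^sup>p\<close> by \<open>P(x)\<close> times \<open>C \<rho>\<close> to the power \<open>-\<gamma>\<close> and by \<open>C \<rho>\<close> to the power
  \<open>-\<alpha> p\<close>.  In each potential the first bound controls the small scales, the second one the large
  scales.  The strict inequality \<open>r < p\<close> leaves room for the exponents.
\<close>

section \<open>Riesz potentials of nonnegative functions\<close>

text \<open>Since \<open>0 powr s = 0\<close>, the kernel vanishes at the origin instead of blowing
  up there. Integrals do not notice this, but pointwise lower bounds on the kernel have to leave out
  that point.\<close>

definition riesz_kernel :: "real \<Rightarrow> 'a::euclidean_space \<Rightarrow> real" where
  "riesz_kernel \<kappa> y = norm y powr (\<kappa> - DIM('a))"

text \<open>This is the potential after a translation of the variable, with values in
  \<open>ennreal\<close> and over \<open>lborel\<close>, so that no convergence question arises and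
  Tonelli applies to Borel functions. The order stays free because two orders occur: \<alpha> for
  the operator itself and a small \<gamma> for the test functions.\<close>

definition nn_riesz :: "real \<Rightarrow> ('a::euclidean_space \<Rightarrow> ennreal) \<Rightarrow> 'a \<Rightarrow> ennreal" where
  "nn_riesz \<kappa> g x = (\<integral>\<^sup>+y. ennreal (riesz_kernel \<kappa> (y - x)) * g y \<partial>lborel)"

lemma riesz_kernel_nonneg [simp]: "0 \<le> riesz_kernel \<kappa> y"
  by (simp add: riesz_kernel_def)

lemma riesz_kernel_minus_commute: "riesz_kernel \<kappa> (y - x) = riesz_kernel \<kappa> (x - y)"
  by (simp add: riesz_kernel_def norm_minus_commute)

lemma riesz_kernel_measurable [measurable]: "riesz_kernel \<kappa> \<in> borel_measurable borel"
  unfolding riesz_kernel_def[abs_def] by measurable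

lemma nn_riesz_measurable [measurable]:
  fixes g :: "'a::euclidean_space \<Rightarrow> ennreal"
  assumes [measurable]: "g \<in> borel_measurable borel"
  shows "nn_riesz \<kappa> g \<in> borel_measurable borel"
  unfolding nn_riesz_def[abs_def] by measurable

section \<open>Dyadic decomposition of Riesz potentials\<close>

lemma ex_pow2_interval:
  fixes y :: real
  assumes "1 \<le> y"
  shows "\<exists>k::nat. 2 ^ k \<le> y \<and> y < 2 * 2 ^ k"
proof -
  define k where "k = nat \<lfloor>log 2 y\<rfloor>"
  have k: "real k = of_int \<lfloor>log 2 y\<rfloor>"
    using assms by (simp add: k_def)
  have "2 ^ k \<le> y"
  proof -
    have "2 powr real k \<le> 2 powr (log 2 y)"
      unfolding k by (intro powr_mono) auto
    then show ?thesis
      using assms by (simp add: powr_realpow)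
  qed
  moreover have "y < 2 * 2 ^ k"
  proof -
    have "2 powr (log 2 y) < 2 powr (real k + 1)"
      unfolding k by (intro powr_less_mono) linarith+
    then show ?thesis
      using assms by (simp add: powr_realpow powr_add)
  qed
  ultimately show ?thesis by blast
qed

text \<open>On the shell of outer radius \<open>t = \<rho> * q ^ k\<close> the kernel is at most a
  constant times \<open>t powr (\<kappa> - d)\<close>, and the mass of \<open>g\<close> is at most
  \<open>K * t powr (d - a)\<close>. The products form a geometric series of ratio
  \<open>q powr (\<kappa> - a)\<close>. Taking \<open>q = 1/2\<close> treats the part near
  \<open>x\<close>, \<open>q = 2\<close> the part far away; the ratio 4 of the shell radii is wide
  enough for both.\<close>

lemma nn_riesz_geometric:
  fixes g :: "'a::euclidean_space \<Rightarrow> ennreal" and \<kappa> a \<rho> q K :: real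
  assumes [measurable]: "g \<in> borel_measurable borel"
    and \<kappa>: "\<kappa> < DIM('a)" and \<rho>: "0 < \<rho>" and q: "0 < q" "q powr (\<kappa> - a) < 1" and K: "0 \<le> K"
    and S: "\<And>y. y \<in> S \<Longrightarrow> y \<noteq> x \<Longrightarrow>
              \<exists>k::nat. \<rho> * q ^ k / 4 \<le> norm (y - x) \<and> norm (y - x) < \<rho> * q ^ k"
    and G: "\<And>t. 0 < t \<Longrightarrow> (\<integral>\<^sup>+y\<in>ball x t. g y \<partial>lborel) \<le> ennreal (K * t powr (DIM('a) - a))"
  shows "(\<integral>\<^sup>+y\<in>S. ennreal (riesz_kernel \<kappa> (y - x)) * g y \<partial>lborel)
           \<le> ennreal (4 powr (DIM('a) - \<kappa>) / (1 - q powr (\<kappa> - a)) * K * \<rho> powr (\<kappa> - a))"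
proof -
  define R where "R k = \<rho> * q ^ k" for k :: nat
  define D where "D = real DIM('a)"
  have R: "0 < R k" for k using \<rho> q by (simp add: R_def)
  \<comment> \<open>As \<kappa> is below the dimension, this value at the inner radius bounds the
    kernel on the whole shell.\<close>
  define w where "w k = (R k / 4) powr (\<kappa> - D)" for k
  have [measurable]: "(\<lambda>y. g y * indicator (ball x t) y) \<in> borel_measurable borel" for t
    by (intro borel_measurable_times_ennreal borel_measurable_indicator) auto
  have w: "0 \<le> w k" for k by (simp add: w_def)
  have "(\<integral>\<^sup>+y\<in>S. ennreal (riesz_kernel \<kappa> (y - x)) * g y \<partial>lborel)
      \<le> (\<integral>\<^sup>+y. (\<Sum>k. ennreal (w k) * (g y * indicator (ball x (R k)) y)) \<partial>lborel)"
  proof (rule nn_integral_mono)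
    fix y
    show "ennreal (riesz_kernel \<kappa> (y - x)) * g y * indicator S y
            \<le> (\<Sum>k. ennreal (w k) * (g y * indicator (ball x (R k)) y))"
    proof (cases "y \<in> S \<and> y \<noteq> x")
      case True
      then obtain k where k: "R k / 4 \<le> norm (y - x)" "norm (y - x) < R k"
        using S[of y] unfolding R_def by blast
      have "riesz_kernel \<kappa> (y - x) \<le> w k"
        unfolding riesz_kernel_def w_def D_def
        using k R[of k] \<kappa> by (intro powr_mono2') auto
      moreover have "y \<in> ball x (R k)"
        using k by (simp add: dist_norm norm_minus_commute)
      ultimately have "ennreal (riesz_kernel \<kappa> (y - x)) * g y * indicator S y
                 \<le> ennreal (w k) * (g y * indicator (ball x (R k)) y)"
        using True by (auto simp: ennreal_leI mult_right_mono)
      also have "\<dots> = (\<Sum>k\<in>{k}. ennreal (w k) * (g y * indicator (ball x (R k)) y))"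
        by simp
      \<comment> \<open>The balls overlap, but one term already dominates and the others are
        nonnegative.\<close>
      also have "\<dots> \<le> (\<Sum>k. ennreal (w k) * (g y * indicator (ball x (R k)) y))"
        by (intro sum_le_suminf) auto
      finally show ?thesis .
    next
      case False
      \<comment> \<open>At \<open>y = x\<close> the kernel is 0 by the convention for
        \<open>powr\<close>, so \<open>S\<close> may contain the centre.\<close>
      then show ?thesis by (auto simp: riesz_kernel_def indicator_def)
    qed
  qed
  also have "\<dots> = (\<Sum>k. \<integral>\<^sup>+y. ennreal (w k) * (g y * indicator (ball x (R k)) y) \<partial>lborel)"
    by (intro nn_integral_suminf) measurable
  also have "\<dots> = (\<Sum>k. ennreal (w k) * (\<integral>\<^sup>+y\<in>ball x (R k). g y \<partial>lborel))"
    by (intro suminf_cong nn_integral_cmult) measurable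
  also have "\<dots> \<le> (\<Sum>k. ennreal (w k) * ennreal (K * R k powr (D - a)))"
    unfolding D_def by (intro suminf_le mult_left_mono G R) auto
  also have "\<dots> = (\<Sum>k. ennreal (4 powr (D - \<kappa>) * K * \<rho> powr (\<kappa> - a) * (q powr (\<kappa> - a)) ^ k))"
  proof (intro suminf_cong)
    fix k
    have "w k * (K * R k powr (D - a)) = 4 powr (D - \<kappa>) * K * R k powr (\<kappa> - a)"
      using R[of k] by (simp add: w_def powr_divide powr_diff field_simps)
    also have "R k powr (\<kappa> - a) = \<rho> powr (\<kappa> - a) * (q powr (\<kappa> - a)) ^ k"
      using \<rho> q by (simp add: R_def powr_mult powr_powr mult.commute flip: powr_realpow)
    finally show "ennreal (w k) * ennreal (K * R k powr (D - a))
                = ennreal (4 powr (D - \<kappa>) * K * \<rho> powr (\<kappa> - a) * (q powr (\<kappa> - a)) ^ k)"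
      using w[of k] K by (simp add: mult_ac flip: ennreal_mult)
  qed
  also have "\<dots> = ennreal (4 powr (D - \<kappa>) * K * \<rho> powr (\<kappa> - a) * (1 / (1 - q powr (\<kappa> - a))))"
    using q K by (intro suminf_ennreal_eq sums_mult geometric_sums) auto
  finally show ?thesis
    by (simp add: D_def mult_ac)
qed

text \<open>The shells shrink towards \<open>x\<close>, and the series converges because
  \<open>a < \<kappa>\<close>.\<close>

lemma nn_riesz_near:
  fixes g :: "'a::euclidean_space \<Rightarrow> ennreal" and \<kappa> a \<rho> K :: real
  assumes "g \<in> borel_measurable borel"
    and "\<kappa> < DIM('a)" "0 < \<rho>" "a < \<kappa>" "0 \<le> K"
    and "\<And>t. 0 < t \<Longrightarrow> (\<integral>\<^sup>+y\<in>ball x t. g y \<partial>lborel) \<le> ennreal (K * t powr (DIM('a) - a))"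
  shows "(\<integral>\<^sup>+y\<in>ball x \<rho>. ennreal (riesz_kernel \<kappa> (y - x)) * g y \<partial>lborel)
           \<le> ennreal (4 powr (DIM('a) - \<kappa>) / (1 - (1/2) powr (\<kappa> - a)) * K * (2 * \<rho>) powr (\<kappa> - a))"
proof (rule nn_riesz_geometric)
  show "(1 / 2) powr (\<kappa> - a) < 1"
    using powr_less_mono2[of "\<kappa> - a" "1/2" "1::real"] assms by simp
  fix y assume y: "y \<in> ball x \<rho>" "y \<noteq> x"
  then have n: "0 < norm (y - x)" "norm (y - x) < \<rho>"
    by (auto simp: dist_norm norm_minus_commute)
  then obtain k where k: "2 ^ k \<le> \<rho> / norm (y - x)" "\<rho> / norm (y - x) < 2 * 2 ^ k"
    using ex_pow2_interval[of "\<rho> / norm (y - x)"] by auto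
  \<comment> \<open>The choice of \<open>k\<close> gives only
    \<open>norm (y - x) \<le> \<rho> * (1/2) ^ k\<close>; starting the radii at
    \<open>2 * \<rho>\<close> makes the upper bound strict.\<close>
  show "\<exists>k::nat. 2 * \<rho> * (1 / 2) ^ k / 4 \<le> norm (y - x) \<and> norm (y - x) < 2 * \<rho> * (1 / 2) ^ k"
    by (rule exI[of _ k]) (use k n in \<open>simp add: field_simps\<close>)
qed (use assms in auto)

text \<open>Here the shells grow, and the series converges because
  \<open>\<kappa> < c\<close>.\<close>

lemma nn_riesz_far:
  fixes g :: "'a::euclidean_space \<Rightarrow> ennreal" and \<kappa> c \<rho> K :: real
  assumes "g \<in> borel_measurable borel"
    and "\<kappa> < DIM('a)" "0 < \<rho>" "\<kappa> < c" "0 \<le> K"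
    and "\<And>t. 0 < t \<Longrightarrow> (\<integral>\<^sup>+y\<in>ball x t. g y \<partial>lborel) \<le> ennreal (K * t powr (DIM('a) - c))"
  shows "(\<integral>\<^sup>+y\<in>- ball x \<rho>. ennreal (riesz_kernel \<kappa> (y - x)) * g y \<partial>lborel)
           \<le> ennreal (4 powr (DIM('a) - \<kappa>) / (1 - 2 powr (\<kappa> - c)) * K * (2 * \<rho>) powr (\<kappa> - c))"
proof (rule nn_riesz_geometric)
  show "2 powr (\<kappa> - c) < 1"
    using powr_less_mono[of "\<kappa> - c" 0 2] assms by simp
  fix y assume y: "y \<in> - ball x \<rho>" "y \<noteq> x"
  then have n: "\<rho> \<le> norm (y - x)"
    by (auto simp: dist_norm norm_minus_commute)
  then obtain k where k: "2 ^ k \<le> norm (y - x) / \<rho>" "norm (y - x) / \<rho> < 2 * 2 ^ k"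
    using ex_pow2_interval[of "norm (y - x) / \<rho>"] assms by auto
  show "\<exists>k::nat. 2 * \<rho> * 2 ^ k / 4 \<le> norm (y - x) \<and> norm (y - x) < 2 * \<rho> * 2 ^ k"
    by (rule exI[of _ k]) (use k n assms in \<open>simp add: field_simps\<close>)
qed (use assms in auto)

text \<open>This is Hedberg's splitting. Cutting at radius \<rho> gives a near part of size
  \<open>K * Q * \<rho> powr (\<kappa> - a)\<close> and a far part of size
  \<open>K * \<rho> powr (\<kappa> - c)\<close>; they agree when
  \<open>Q * \<rho> powr (c - a) = 1\<close>. The constant comes first in the quantifiers, so it is
  uniform in \<open>g\<close>, \<open>x\<close>, \<open>K\<close> and \<open>Q\<close>.\<close>

lemma nn_riesz_interpolate:
  fixes \<kappa> a c :: real
  assumes "a < \<kappa>" "\<kappa> < c" "\<kappa> < DIM('a)"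
  shows "\<exists>C>0. \<forall>(g::'a::euclidean_space \<Rightarrow> ennreal) x (K::real) Q. g \<in> borel_measurable borel \<longrightarrow> 0 \<le> K \<longrightarrow> 0 < Q \<longrightarrow>
     (\<forall>t>0. (\<integral>\<^sup>+y\<in>ball x t. g y \<partial>lborel) \<le> ennreal (K * Q * t powr (DIM('a) - a))) \<longrightarrow>
     (\<forall>t>0. (\<integral>\<^sup>+y\<in>ball x t. g y \<partial>lborel) \<le> ennreal (K * t powr (DIM('a) - c))) \<longrightarrow>
     nn_riesz \<kappa> g x \<le> ennreal (C * K * Q powr ((c - \<kappa>) / (c - a)))"
proof -
  define Ca where "Ca = 4 powr (DIM('a) - \<kappa>) / (1 - (1/2) powr (\<kappa> - a)) * 2 powr (\<kappa> - a)"
  define Cc where "Cc = 4 powr (DIM('a) - \<kappa>) / (1 - 2 powr (\<kappa> - c)) * 2 powr (\<kappa> - c)"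
  have "(1 / 2) powr (\<kappa> - a) < 1"
    using powr_less_mono2[of "\<kappa> - a" "1/2" "1::real"] assms by simp
  then have Ca: "0 < Ca" by (simp add: Ca_def)
  have "2 powr (\<kappa> - c) < 1"
    using powr_less_mono[of "\<kappa> - c" 0 2] assms by simp
  then have Cc: "0 < Cc" by (simp add: Cc_def)
  show ?thesis
  proof (intro exI[of _ "Ca + Cc"] conjI allI impI)
    show "0 < Ca + Cc" using Ca Cc by simp
    fix g :: "'a \<Rightarrow> ennreal" and x :: 'a and K Q :: real
    assume g[measurable]: "g \<in> borel_measurable borel" and K: "0 \<le> K" and Q: "0 < Q"
    assume near: "\<forall>t>0. (\<integral>\<^sup>+y\<in>ball x t. g y \<partial>lborel) \<le> ennreal (K * Q * t powr (DIM('a) - a))"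
      and far: "\<forall>t>0. (\<integral>\<^sup>+y\<in>ball x t. g y \<partial>lborel) \<le> ennreal (K * t powr (DIM('a) - c))"
    \<comment> \<open>the radius at which the near and the far bound balance\<close>
    define \<rho> where "\<rho> = Q powr (- 1 / (c - a))"
    have \<rho>: "0 < \<rho>" using Q by (simp add: \<rho>_def)
    define E where "E = Q powr ((c - \<kappa>) / (c - a))"
    have "nn_riesz \<kappa> g x = (\<integral>\<^sup>+y\<in>ball x \<rho>. ennreal (riesz_kernel \<kappa> (y - x)) * g y \<partial>lborel)
        + (\<integral>\<^sup>+y\<in>- ball x \<rho>. ennreal (riesz_kernel \<kappa> (y - x)) * g y \<partial>lborel)"
      unfolding nn_riesz_def
      by (subst nn_integral_add[symmetric]) (auto intro!: nn_integral_cong simp: indicator_def)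
    also have "\<dots> \<le> ennreal (4 powr (DIM('a) - \<kappa>) / (1 - (1/2) powr (\<kappa> - a)) * (K * Q) * (2 * \<rho>) powr (\<kappa> - a))
      + ennreal (4 powr (DIM('a) - \<kappa>) / (1 - 2 powr (\<kappa> - c)) * K * (2 * \<rho>) powr (\<kappa> - c))"
      using assms K Q \<rho> near far
      by (intro add_mono nn_riesz_near nn_riesz_far) auto
    also have "4 powr (DIM('a) - \<kappa>) / (1 - (1/2) powr (\<kappa> - a)) * (K * Q) * (2 * \<rho>) powr (\<kappa> - a)
       = Ca * K * E"
    proof -
      have "Q * \<rho> powr (\<kappa> - a) = Q powr (1 + (- 1 / (c - a)) * (\<kappa> - a))"
        using Q by (simp only: \<rho>_def powr_powr powr_add) simp
      also have "1 + (- 1 / (c - a)) * (\<kappa> - a) = (c - \<kappa>) / (c - a)"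
        using assms by (simp add: field_simps)
      finally have *: "Q * \<rho> powr (\<kappa> - a) = E" by (simp add: E_def)
      show ?thesis unfolding *[symmetric] using \<rho> by (simp add: Ca_def powr_mult)
    qed
    also have "4 powr (DIM('a) - \<kappa>) / (1 - 2 powr (\<kappa> - c)) * K * (2 * \<rho>) powr (\<kappa> - c) = Cc * K * E"
    proof -
      have "\<rho> powr (\<kappa> - c) = Q powr ((- 1 / (c - a)) * (\<kappa> - c))"
        using Q by (simp only: \<rho>_def powr_powr)
      also have "(- 1 / (c - a)) * (\<kappa> - c) = (c - \<kappa>) / (c - a)"
        using assms by (simp add: field_simps)
      finally have *: "\<rho> powr (\<kappa> - c) = E" by (simp add: E_def)
      show ?thesis unfolding *[symmetric] using \<rho> by (simp add: Cc_def powr_mult)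
    qed
    also have "ennreal (Ca * K * E) + ennreal (Cc * K * E) = ennreal ((Ca + Cc) * K * E)"
      using Ca Cc K by (simp add: E_def algebra_simps flip: ennreal_plus)
    finally show "nn_riesz \<kappa> g x \<le> ennreal ((Ca + Cc) * K * Q powr ((c - \<kappa>) / (c - a)))"
      by (simp add: E_def)
  qed
qed

section \<open>Averages over balls\<close>

lemma emeasure_ball_powr:
  assumes "0 < t"
  shows "emeasure lborel (ball (x::'a::euclidean_space) t)
           = ennreal (unit_ball_vol DIM('a) * t powr DIM('a))"
  using assms by (simp add: emeasure_ball powr_realpow)

text \<open>A crude weighted AM-GM inequality; the summand 1 pays for the weight
  \<open>1 - s - t\<close> that is left over. Everything is compared with the maximum of
  \<open>u\<close>, \<open>v\<close> and 1.\<close>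

lemma powr_mult_powr_le_sum:
  fixes u v s t :: real
  assumes "0 \<le> u" "0 \<le> v" "0 \<le> s" "0 \<le> t" "s + t \<le> 1"
  shows "u powr s * v powr t \<le> u + v + 1"
proof -
  define m where "m = max 1 (max u v)"
  have "u powr s * v powr t \<le> m powr s * m powr t"
    using assms by (intro mult_mono powr_mono2) (auto simp: m_def)
  also have "\<dots> = m powr (s + t)"
    by (simp add: powr_add)
  also have "\<dots> \<le> m powr 1"
    using assms by (intro powr_mono) (auto simp: m_def)
  also have "\<dots> \<le> u + v + 1"
    using assms by (auto simp: m_def)
  finally show ?thesis .
qed

text \<open>Hoelder's inequality for averages, with \<open>m\<close> in the role of the measure of
  \<open>B\<close>: if \<open>u\<close> and \<open>v\<close> have averages at most \<beta> and
  \<pi>, the average of the product of powers is controlled by the same powers of \<beta> and \<pi>.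
  The factor 3 counts the three summands of the pointwise inequality.\<close>

lemma nn_integral_powr_mult_powr_le:
  fixes u v :: "'a \<Rightarrow> real" and \<beta> \<pi> m s t :: real
  assumes [measurable]: "u \<in> borel_measurable M" "v \<in> borel_measurable M" "B \<in> sets M"
    and pos: "\<And>x. 0 \<le> u x" "\<And>x. 0 \<le> v x" "0 < \<beta>" "0 < \<pi>" "0 \<le> m"
    and st: "0 \<le> s" "0 \<le> t" "s + t \<le> 1"
    and u: "(\<integral>\<^sup>+x\<in>B. ennreal (u x) \<partial>M) \<le> ennreal (\<beta> * m)"
    and v: "(\<integral>\<^sup>+x\<in>B. ennreal (v x) \<partial>M) \<le> ennreal (\<pi> * m)"
    and B: "emeasure M B \<le> ennreal m"
  shows "(\<integral>\<^sup>+x\<in>B. ennreal (u x powr s * v x powr t) \<partial>M)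
           \<le> ennreal (3 * \<beta> powr s * \<pi> powr t * m)"
proof -
  define c where "c = \<beta> powr s * \<pi> powr t"
  have c: "0 < c" using pos by (simp add: c_def)
  \<comment> \<open>The pointwise inequality is applied to the normalised functions
    \<open>u / \<beta>\<close> and \<open>v / \<pi>\<close>.\<close>
  have "u x powr s * v x powr t \<le> c * (u x / \<beta> + v x / \<pi> + 1)" for x
    using powr_mult_powr_le_sum[of "u x / \<beta>" "v x / \<pi>" s t] pos st
    by (simp add: c_def powr_divide field_simps)
  then have "(\<integral>\<^sup>+x\<in>B. ennreal (u x powr s * v x powr t) \<partial>M)
     \<le> (\<integral>\<^sup>+x. ennreal (c / \<beta>) * (ennreal (u x) * indicator B x)
          + (ennreal (c / \<pi>) * (ennreal (v x) * indicator B x) + ennreal c * indicator B x) \<partial>M)"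
    using pos c
    by (intro nn_integral_mono)
       (auto simp: indicator_def algebra_simps intro!: ennreal_leI
             simp flip: ennreal_mult ennreal_plus)
  also have "\<dots> = ennreal (c / \<beta>) * (\<integral>\<^sup>+x\<in>B. ennreal (u x) \<partial>M)
          + (ennreal (c / \<pi>) * (\<integral>\<^sup>+x\<in>B. ennreal (v x) \<partial>M) + ennreal c * emeasure M B)"
    by (simp add: nn_integral_add nn_integral_cmult nn_integral_cmult_indicator)
  also have "\<dots> \<le> ennreal (c / \<beta>) * ennreal (\<beta> * m)
          + (ennreal (c / \<pi>) * ennreal (\<pi> * m) + ennreal c * ennreal m)"
    by (intro add_mono mult_left_mono u v B) auto
  also have "\<dots> = ennreal (3 * c * m)"
    using pos c by (simp add: algebra_simps flip: ennreal_mult ennreal_plus)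
  finally show ?thesis by (simp add: c_def mult_ac)
qed

text \<open>If the pole \<open>z\<close> is within \<open>2 * \<rho>\<close> of \<open>x\<close>,
  the singularity is integrated over a ball of comparable radius around \<open>z\<close>. Otherwise
  every \<open>y\<close> in the ball is at distance at least \<open>norm (z - x) / 2\<close> from
  \<open>z\<close>, so the kernel is comparable to its value at the centre.\<close>

lemma riesz_kernel_ball_average:
  fixes \<kappa> :: real
  assumes "0 < \<kappa>" "\<kappa> < DIM('a::euclidean_space)"
  shows "\<exists>C>0. \<forall>(x::'a) z \<rho>. 0 < \<rho> \<longrightarrow>
     (\<integral>\<^sup>+y\<in>ball x \<rho>. ennreal (riesz_kernel \<kappa> (y - z)) \<partial>lborel)
        \<le> ennreal (C * \<rho> powr \<kappa>) * indicator (ball x (2 * \<rho>)) z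
          + ennreal (C * \<rho> powr DIM('a) * riesz_kernel \<kappa> (z - x)) * indicator (- ball x (2 * \<rho>)) z"
proof -
  define D where "D = real DIM('a)"
  define \<omega> where "\<omega> = unit_ball_vol D"
  have \<omega>: "0 < \<omega>" by (simp add: \<omega>_def D_def)
  define C1 where "C1 = 4 powr (D - \<kappa>) / (1 - (1/2) powr \<kappa>) * \<omega> * 6 powr \<kappa>"
  define C2 where "C2 = \<omega> * 2 powr (D - \<kappa>)"
  have "(1 / 2) powr \<kappa> < 1"
    using powr_less_mono2[of \<kappa> "1/2" "1::real"] assms by simp
  then have C1: "0 < C1" using \<omega> by (simp add: C1_def)
  have C2: "0 < C2" using \<omega> by (simp add: C2_def)
  show ?thesis
  proof (intro exI[of _ "C1 + C2"] conjI allI impI)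
    show "0 < C1 + C2" using C1 C2 by simp
    fix x z :: 'a and \<rho> :: real assume \<rho>: "0 < \<rho>"
    let ?L = "\<integral>\<^sup>+y\<in>ball x \<rho>. ennreal (riesz_kernel \<kappa> (y - z)) \<partial>lborel"
    show "?L \<le> ennreal ((C1 + C2) * \<rho> powr \<kappa>) * indicator (ball x (2 * \<rho>)) z
          + ennreal ((C1 + C2) * \<rho> powr DIM('a) * riesz_kernel \<kappa> (z - x)) * indicator (- ball x (2 * \<rho>)) z"
    proof (cases "z \<in> ball x (2 * \<rho>)")
      case True
      have "?L \<le> (\<integral>\<^sup>+y\<in>ball z (3 * \<rho>). ennreal (riesz_kernel \<kappa> (y - z)) * 1 \<partial>lborel)"
      proof (intro nn_integral_mono)
        fix y
        have "y \<in> ball x \<rho> \<Longrightarrow> y \<in> ball z (3 * \<rho>)"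
          using True dist_triangle[of z y x] by (simp add: dist_commute)
        then show "ennreal (riesz_kernel \<kappa> (y - z)) * indicator (ball x \<rho>) y
          \<le> ennreal (riesz_kernel \<kappa> (y - z)) * 1 * indicator (ball z (3 * \<rho>)) y"
          by (auto simp: indicator_def)
      qed
      \<comment> \<open>The near estimate for the constant function 1, whose mass on balls has
        \<open>a = 0\<close> and \<open>K = \<omega>\<close>.\<close>
      also have "\<dots> \<le> ennreal (4 powr (DIM('a) - \<kappa>) / (1 - (1/2) powr (\<kappa> - 0)) * \<omega>
                         * (2 * (3 * \<rho>)) powr (\<kappa> - 0))"
        using assms \<rho> \<omega>
        by (intro nn_riesz_near) (auto simp: emeasure_ball_powr \<omega>_def D_def)
      also have "\<dots> = ennreal (C1 * \<rho> powr \<kappa>)"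
        using \<rho> by (simp add: C1_def D_def powr_mult mult_ac)
      also have "\<dots> \<le> ennreal ((C1 + C2) * \<rho> powr \<kappa>)"
        using C1 C2 by (intro ennreal_leI mult_right_mono) auto
      finally show ?thesis using True by simp
    next
      case False
      have "?L \<le> (\<integral>\<^sup>+y. ennreal (2 powr (D - \<kappa>) * riesz_kernel \<kappa> (z - x)) * indicator (ball x \<rho>) y \<partial>lborel)"
      proof (intro nn_integral_mono)
        fix y :: 'a
        show "ennreal (riesz_kernel \<kappa> (y - z)) * indicator (ball x \<rho>) y
           \<le> ennreal (2 powr (D - \<kappa>) * riesz_kernel \<kappa> (z - x)) * indicator (ball x \<rho>) y"
        proof (cases "y \<in> ball x \<rho>")
          case True
          have z: "2 * \<rho> \<le> norm (z - x)"
            using False by (simp add: dist_norm norm_minus_commute)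
          moreover have "norm (z - x) \<le> norm (y - z) + norm (y - x)"
            using norm_triangle_ineq4[of "y - x" "y - z"] by simp
          moreover have "norm (y - x) < \<rho>"
            using True by (simp add: dist_norm norm_minus_commute)
          ultimately have n: "norm (z - x) / 2 \<le> norm (y - z)" by linarith
          have "riesz_kernel \<kappa> (y - z) \<le> (norm (z - x) / 2) powr (\<kappa> - D)"
            unfolding riesz_kernel_def D_def
            using n z \<rho> assms by (intro powr_mono2') auto
          also have "\<dots> = 2 powr (D - \<kappa>) * riesz_kernel \<kappa> (z - x)"
            by (simp add: riesz_kernel_def D_def powr_divide powr_diff field_simps)
          finally show ?thesis by (intro mult_right_mono ennreal_leI) auto
        qed simp
      qed
      also have "\<dots> = ennreal (2 powr (D - \<kappa>) * riesz_kernel \<kappa> (z - x)) * ennreal (\<omega> * \<rho> powr D)"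
        using \<rho> by (simp add: nn_integral_cmult_indicator emeasure_ball_powr \<omega>_def D_def)
      also have "\<dots> = ennreal (C2 * \<rho> powr D * riesz_kernel \<kappa> (z - x))"
        using \<omega> by (simp add: C2_def mult_ac flip: ennreal_mult)
      also have "\<dots> \<le> ennreal ((C1 + C2) * \<rho> powr D * riesz_kernel \<kappa> (z - x))"
        using C1 C2 by (intro ennreal_leI mult_right_mono) auto
      finally show ?thesis using False by (simp add: D_def)
    qed
  qed
qed

text \<open>By Tonelli, the average of a potential is the integral of \<open>g\<close> against the
  averaged kernel.\<close>

lemma nn_riesz_ball_average:
  fixes \<kappa> :: real
  assumes "0 < \<kappa>" "\<kappa> < DIM('a::euclidean_space)"
  shows "\<exists>C>0. \<forall>(g::'a \<Rightarrow> ennreal) x \<rho>. g \<in> borel_measurable borel \<longrightarrow> 0 < \<rho> \<longrightarrow>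
     (\<integral>\<^sup>+y\<in>ball x \<rho>. nn_riesz \<kappa> g y \<partial>lborel)
        \<le> ennreal (C * \<rho> powr \<kappa>) * (\<integral>\<^sup>+z\<in>ball x (2 * \<rho>). g z \<partial>lborel)
          + ennreal (C * \<rho> powr DIM('a))
            * (\<integral>\<^sup>+z\<in>- ball x (2 * \<rho>). ennreal (riesz_kernel \<kappa> (z - x)) * g z \<partial>lborel)"
proof -
  obtain C where C: "0 < C" and K: "\<And>(x::'a) z \<rho>. 0 < \<rho> \<Longrightarrow>
     (\<integral>\<^sup>+y\<in>ball x \<rho>. ennreal (riesz_kernel \<kappa> (y - z)) \<partial>lborel)
        \<le> ennreal (C * \<rho> powr \<kappa>) * indicator (ball x (2 * \<rho>)) z
          + ennreal (C * \<rho> powr DIM('a) * riesz_kernel \<kappa> (z - x)) * indicator (- ball x (2 * \<rho>)) z"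
    using riesz_kernel_ball_average[OF assms] by blast
  show ?thesis
  proof (intro exI[of _ C] conjI allI impI)
    fix g :: "'a \<Rightarrow> ennreal" and x :: 'a and \<rho> :: real
    assume [measurable]: "g \<in> borel_measurable borel" and \<rho>: "0 < \<rho>"
    have [measurable]: "(\<lambda>y. indicator (ball x t) y :: ennreal) \<in> borel_measurable borel"
      "(\<lambda>y. indicator (- ball x t) y :: ennreal) \<in> borel_measurable borel" for t
      by (intro borel_measurable_indicator; auto)+
    have "(\<integral>\<^sup>+y\<in>ball x \<rho>. nn_riesz \<kappa> g y \<partial>lborel)
        = (\<integral>\<^sup>+y. \<integral>\<^sup>+z. (ennreal (riesz_kernel \<kappa> (z - y)) * indicator (ball x \<rho>) y) * g z \<partial>lborel \<partial>lborel)"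
      unfolding nn_riesz_def
      by (intro nn_integral_cong, subst nn_integral_multc[symmetric])
         (measurable, simp add: mult_ac)
    also have "\<dots> = (\<integral>\<^sup>+z. \<integral>\<^sup>+y. (ennreal (riesz_kernel \<kappa> (z - y)) * indicator (ball x \<rho>) y) * g z \<partial>lborel \<partial>lborel)"
      by (rule lborel_pair.Fubini') measurable
    also have "\<dots> = (\<integral>\<^sup>+z. (\<integral>\<^sup>+y\<in>ball x \<rho>. ennreal (riesz_kernel \<kappa> (y - z)) \<partial>lborel) * g z \<partial>lborel)"
      by (subst nn_integral_multc) (simp_all add: riesz_kernel_minus_commute)
    also have "\<dots> \<le> (\<integral>\<^sup>+z. (ennreal (C * \<rho> powr \<kappa>) * indicator (ball x (2 * \<rho>)) z
          + ennreal (C * \<rho> powr DIM('a) * riesz_kernel \<kappa> (z - x)) * indicator (- ball x (2 * \<rho>)) z) * g z \<partial>lborel)"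
      by (intro nn_integral_mono mult_right_mono K \<rho>) auto
    also have "\<dots> = (\<integral>\<^sup>+z. ennreal (C * \<rho> powr \<kappa>) * (g z * indicator (ball x (2 * \<rho>)) z)
        + ennreal (C * \<rho> powr DIM('a)) * (ennreal (riesz_kernel \<kappa> (z - x)) * g z * indicator (- ball x (2 * \<rho>)) z) \<partial>lborel)"
      using C by (intro nn_integral_cong) (auto simp: indicator_def ennreal_mult mult_ac)
    also have "\<dots> = ennreal (C * \<rho> powr \<kappa>) * (\<integral>\<^sup>+z\<in>ball x (2 * \<rho>). g z \<partial>lborel)
          + ennreal (C * \<rho> powr DIM('a))
            * (\<integral>\<^sup>+z\<in>- ball x (2 * \<rho>). ennreal (riesz_kernel \<kappa> (z - x)) * g z \<partial>lborel)"
      by (simp add: nn_integral_add nn_integral_cmult)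
    finally show "(\<integral>\<^sup>+y\<in>ball x \<rho>. nn_riesz \<kappa> g y \<partial>lborel)
        \<le> ennreal (C * \<rho> powr \<kappa>) * (\<integral>\<^sup>+z\<in>ball x (2 * \<rho>). g z \<partial>lborel)
          + ennreal (C * \<rho> powr DIM('a))
            * (\<integral>\<^sup>+z\<in>- ball x (2 * \<rho>). ennreal (riesz_kernel \<kappa> (z - x)) * g z \<partial>lborel)" .
  qed (rule C)
qed

text \<open>On the ball, away from its centre, the kernel is at least
  \<open>\<rho> powr (\<kappa> - d)\<close>.\<close>

lemma nn_integral_ball_le_nn_riesz:
  fixes g :: "'a::euclidean_space \<Rightarrow> ennreal" and \<kappa> \<rho> :: real
  assumes [measurable]: "g \<in> borel_measurable borel" and "0 < \<rho>" "\<kappa> < DIM('a)"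
  shows "(\<integral>\<^sup>+y\<in>ball x \<rho>. g y \<partial>lborel) \<le> ennreal (\<rho> powr (DIM('a) - \<kappa>)) * nn_riesz \<kappa> g x"
proof -
  \<comment> \<open>The lower bound fails at the centre, where the kernel takes the value 0.\<close>
  have "AE y in lborel. y \<noteq> x"
    by (rule AE_lborel_singleton)
  then have "(\<integral>\<^sup>+y\<in>ball x \<rho>. g y \<partial>lborel)
     \<le> (\<integral>\<^sup>+y. ennreal (\<rho> powr (DIM('a) - \<kappa>)) * (ennreal (riesz_kernel \<kappa> (y - x)) * g y) \<partial>lborel)"
  proof (intro nn_integral_mono_AE, eventually_elim)
    case (elim y)
    show ?case
    proof (cases "y \<in> ball x \<rho>")
      case True
      have "(\<rho>::real) powr (\<kappa> - DIM('a)) \<le> riesz_kernel \<kappa> (y - x)"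
        unfolding riesz_kernel_def
        using True elim assms by (intro powr_mono2') (auto simp: dist_norm norm_minus_commute)
      then have "\<rho> powr (DIM('a) - \<kappa>) * \<rho> powr (\<kappa> - DIM('a))
                   \<le> \<rho> powr (DIM('a) - \<kappa>) * riesz_kernel \<kappa> (y - x)"
        by (intro mult_left_mono) auto
      then have "1 \<le> \<rho> powr (DIM('a) - \<kappa>) * riesz_kernel \<kappa> (y - x)"
        using assms by (simp flip: powr_add)
      then have "ennreal 1 * g y \<le> ennreal (\<rho> powr (DIM('a) - \<kappa>) * riesz_kernel \<kappa> (y - x)) * g y"
        by (intro mult_right_mono ennreal_leI) auto
      then show ?thesis
        using True by (simp add: ennreal_mult mult_ac)
    qed simp
  qed
  also have "\<dots> = ennreal (\<rho> powr (DIM('a) - \<kappa>)) * nn_riesz \<kappa> g x"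
    by (simp add: nn_riesz_def nn_integral_cmult)
  finally show ?thesis .
qed

section \<open>Test functions for Morrey weights\<close>

text \<open>A Riesz potential behaves like an A_1 weight, which is what replaces the maximal
  function. The mass of \<open>g\<close> near \<open>x\<close> is controlled by the potential at
  \<open>x\<close>, and the far part is itself a piece of that potential.\<close>

lemma nn_riesz_ball_average_le_self:
  fixes \<kappa> :: real
  assumes "0 < \<kappa>" "\<kappa> < DIM('a::euclidean_space)"
  shows "\<exists>C>0. \<forall>(g::'a \<Rightarrow> ennreal) x \<rho>. g \<in> borel_measurable borel \<longrightarrow> 0 < \<rho> \<longrightarrow>
     (\<integral>\<^sup>+y\<in>ball x \<rho>. nn_riesz \<kappa> g y \<partial>lborel) \<le> ennreal (C * \<rho> powr DIM('a)) * nn_riesz \<kappa> g x"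
proof -
  obtain C where C: "0 < C" and avg: "\<And>(g::'a \<Rightarrow> ennreal) x \<rho>. g \<in> borel_measurable borel \<Longrightarrow> 0 < \<rho> \<Longrightarrow>
     (\<integral>\<^sup>+y\<in>ball x \<rho>. nn_riesz \<kappa> g y \<partial>lborel)
        \<le> ennreal (C * \<rho> powr \<kappa>) * (\<integral>\<^sup>+z\<in>ball x (2 * \<rho>). g z \<partial>lborel)
          + ennreal (C * \<rho> powr DIM('a))
            * (\<integral>\<^sup>+z\<in>- ball x (2 * \<rho>). ennreal (riesz_kernel \<kappa> (z - x)) * g z \<partial>lborel)"
    using nn_riesz_ball_average[OF assms] by blast
  define B where "B = C * 2 powr (DIM('a) - \<kappa>)"
  have B: "0 < B" using C by (simp add: B_def)
  show ?thesis
  proof (intro exI[of _ "B + C"] conjI allI impI)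
    show "0 < B + C" using B C by simp
    fix g :: "'a \<Rightarrow> ennreal" and x :: 'a and \<rho> :: real
    assume g: "g \<in> borel_measurable borel" and \<rho>: "0 < \<rho>"
    let ?P = "nn_riesz \<kappa> g x"
    have "(\<integral>\<^sup>+y\<in>ball x \<rho>. nn_riesz \<kappa> g y \<partial>lborel)
        \<le> ennreal (C * \<rho> powr \<kappa>) * (\<integral>\<^sup>+z\<in>ball x (2 * \<rho>). g z \<partial>lborel)
          + ennreal (C * \<rho> powr DIM('a))
            * (\<integral>\<^sup>+z\<in>- ball x (2 * \<rho>). ennreal (riesz_kernel \<kappa> (z - x)) * g z \<partial>lborel)"
      by (rule avg[OF g \<rho>])
    also have "\<dots> \<le> ennreal (C * \<rho> powr \<kappa>) * (ennreal ((2 * \<rho>) powr (DIM('a) - \<kappa>)) * ?P)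
          + ennreal (C * \<rho> powr DIM('a)) * ?P"
    proof (intro add_mono mult_left_mono)
      show "(\<integral>\<^sup>+z\<in>ball x (2 * \<rho>). g z \<partial>lborel) \<le> ennreal ((2 * \<rho>) powr (DIM('a) - \<kappa>)) * ?P"
        using g \<rho> assms by (intro nn_integral_ball_le_nn_riesz) auto
      show "(\<integral>\<^sup>+z\<in>- ball x (2 * \<rho>). ennreal (riesz_kernel \<kappa> (z - x)) * g z \<partial>lborel) \<le> ?P"
        unfolding nn_riesz_def by (intro nn_integral_mono) (simp add: indicator_def)
    qed auto
    also have "\<dots> = ennreal (C * \<rho> powr \<kappa> * (2 * \<rho>) powr (DIM('a) - \<kappa>) + C * \<rho> powr DIM('a)) * ?P"
      using C by (simp add: ennreal_mult distrib_right distrib_left mult_ac)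
    also have "C * \<rho> powr \<kappa> * (2 * \<rho>) powr (DIM('a) - \<kappa>) + C * \<rho> powr DIM('a)
                 = (B + C) * \<rho> powr DIM('a)"
      using \<rho> by (simp add: B_def powr_mult powr_diff field_simps)
    finally show "(\<integral>\<^sup>+y\<in>ball x \<rho>. nn_riesz \<kappa> g y \<partial>lborel)
                    \<le> ennreal ((B + C) * \<rho> powr DIM('a)) * ?P" .
  qed
qed

text \<open>A potential of order \<kappa> improves Morrey decay of order \<sigma> to order
  \<open>\<sigma> - \<kappa>\<close>: the near mass is bounded by the hypothesis directly, the far
  integral by summing over growing shells.\<close>

lemma nn_riesz_ball_average_le_morrey:
  fixes \<kappa> \<sigma> :: real
  assumes "0 < \<kappa>" "\<kappa> < DIM('a::euclidean_space)" "\<kappa> < \<sigma>"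
  shows "\<exists>C>0. \<forall>(g::'a \<Rightarrow> ennreal) K x \<rho>. g \<in> borel_measurable borel \<longrightarrow> 0 \<le> K \<longrightarrow> 0 < \<rho> \<longrightarrow>
     (\<forall>t>0. (\<integral>\<^sup>+y\<in>ball x t. g y \<partial>lborel) \<le> ennreal (K * t powr (DIM('a) - \<sigma>))) \<longrightarrow>
     (\<integral>\<^sup>+y\<in>ball x \<rho>. nn_riesz \<kappa> g y \<partial>lborel) \<le> ennreal (C * K * \<rho> powr (DIM('a) + \<kappa> - \<sigma>))"
proof -
  obtain C where C: "0 < C" and avg: "\<And>(g::'a \<Rightarrow> ennreal) x \<rho>. g \<in> borel_measurable borel \<Longrightarrow> 0 < \<rho> \<Longrightarrow>
     (\<integral>\<^sup>+y\<in>ball x \<rho>. nn_riesz \<kappa> g y \<partial>lborel)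
        \<le> ennreal (C * \<rho> powr \<kappa>) * (\<integral>\<^sup>+z\<in>ball x (2 * \<rho>). g z \<partial>lborel)
          + ennreal (C * \<rho> powr DIM('a))
            * (\<integral>\<^sup>+z\<in>- ball x (2 * \<rho>). ennreal (riesz_kernel \<kappa> (z - x)) * g z \<partial>lborel)"
    using nn_riesz_ball_average[OF assms(1,2)] by blast
  define F where "F = 4 powr (DIM('a) - \<kappa>) / (1 - 2 powr (\<kappa> - \<sigma>))"
  have "2 powr (\<kappa> - \<sigma>) < 1"
    using powr_less_mono[of "\<kappa> - \<sigma>" 0 2] assms by simp
  then have F: "0 < F" by (simp add: F_def)
  define B where "B = C * 2 powr (DIM('a) - \<sigma>) + C * F * 4 powr (\<kappa> - \<sigma>)"
  have B: "0 < B" using C F by (simp add: B_def add_pos_pos)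
  show ?thesis
  proof (intro exI[of _ B] conjI allI impI B)
    fix g :: "'a \<Rightarrow> ennreal" and x :: 'a and K \<rho> :: real
    assume g: "g \<in> borel_measurable borel" and K: "0 \<le> K" and \<rho>: "0 < \<rho>"
      and G: "\<forall>t>0. (\<integral>\<^sup>+y\<in>ball x t. g y \<partial>lborel) \<le> ennreal (K * t powr (DIM('a) - \<sigma>))"
    have "(\<integral>\<^sup>+y\<in>ball x \<rho>. nn_riesz \<kappa> g y \<partial>lborel)
        \<le> ennreal (C * \<rho> powr \<kappa>) * (\<integral>\<^sup>+z\<in>ball x (2 * \<rho>). g z \<partial>lborel)
          + ennreal (C * \<rho> powr DIM('a))
            * (\<integral>\<^sup>+z\<in>- ball x (2 * \<rho>). ennreal (riesz_kernel \<kappa> (z - x)) * g z \<partial>lborel)"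
      by (rule avg[OF g \<rho>])
    also have "\<dots> \<le> ennreal (C * \<rho> powr \<kappa>) * ennreal (K * (2 * \<rho>) powr (DIM('a) - \<sigma>))
          + ennreal (C * \<rho> powr DIM('a)) * ennreal (F * K * (2 * (2 * \<rho>)) powr (\<kappa> - \<sigma>))"
      unfolding F_def using g K \<rho> G assms
      by (intro add_mono mult_left_mono nn_riesz_far) auto
    also have "\<dots> = ennreal (C * \<rho> powr \<kappa> * (K * (2 * \<rho>) powr (DIM('a) - \<sigma>))
          + C * \<rho> powr DIM('a) * (F * K * (2 * (2 * \<rho>)) powr (\<kappa> - \<sigma>)))"
      using C F K by (simp flip: ennreal_mult ennreal_plus)
    also have "C * \<rho> powr \<kappa> * (K * (2 * \<rho>) powr (DIM('a) - \<sigma>))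
          + C * \<rho> powr DIM('a) * (F * K * (2 * (2 * \<rho>)) powr (\<kappa> - \<sigma>))
         = B * K * \<rho> powr (DIM('a) + \<kappa> - \<sigma>)"
      using \<rho> by (simp add: B_def powr_mult powr_diff powr_add field_simps)
    finally show "(\<integral>\<^sup>+y\<in>ball x \<rho>. nn_riesz \<kappa> g y \<partial>lborel)
                    \<le> ennreal (B * K * \<rho> powr (DIM('a) + \<kappa> - \<sigma>))" .
  qed
qed

text \<open>Equality fails only at \<open>top\<close>, which \<open>enn2real\<close> sends to
  0.\<close>

lemma ennreal_enn2real_le: "ennreal (enn2real x) \<le> x"
  by (cases x) auto

text \<open>These are the two Schur conditions for the test functions \<open>P powr \<delta>\<close>
  and \<open>P powr (\<delta> - 1 / \<mu>)\<close>; raising the second to the power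
  \<open>r - 1\<close> gives the exponent \<theta>. Large-scale averages of \<open>P\<close> decay
  like \<open>t powr (- \<alpha> * \<mu>)\<close>, so a potential of order \<alpha> costs the power
  \<open>1 / \<mu>\<close> of \<open>P\<close>. The condition \<open>1 / \<mu> < \<delta>\<close>
  makes the decay at large scales fast enough, while \<open>\<delta> \<le> 1\<close> and
  \<open>\<theta> \<le> 1 - r / p\<close> allow Hoelder's inequality on balls.\<close>

lemma nn_riesz_test_functions:
  fixes \<alpha> \<gamma> p r \<delta> :: real
  defines "\<mu> \<equiv> p - \<gamma> / \<alpha>"
  defines "\<theta> \<equiv> (\<delta> - 1 / \<mu>) * (r - 1)"
  assumes \<alpha>: "0 < \<alpha>" "\<alpha> < DIM('a::euclidean_space)" and r: "1 < r" "r < p"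
    and \<gamma>: "0 < \<gamma>" "\<gamma> < \<alpha>" "1 < \<mu>" and \<delta>: "1 / \<mu> < \<delta>" "\<delta> \<le> 1" and \<theta>: "\<theta> \<le> 1 - r / p"
  shows "\<exists>C>0. \<forall>(b::'a \<Rightarrow> real) x. b \<in> borel_measurable borel \<longrightarrow> (\<forall>y. 0 \<le> b y) \<longrightarrow>
     (\<forall>t>0. \<forall>z. (\<integral>\<^sup>+y\<in>ball z t. ennreal (b y powr p) \<partial>lborel)
         \<le> ennreal (unit_ball_vol DIM('a) * t powr (DIM('a) - \<alpha> * p))) \<longrightarrow>
     (let P = nn_riesz \<gamma> (\<lambda>y. ennreal (b y powr p)) in
       0 < P x \<longrightarrow> P x < \<infinity> \<longrightarrow>
       nn_riesz \<alpha> (\<lambda>y. ennreal (enn2real (P y) powr \<delta>)) x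
         \<le> ennreal (C * enn2real (P x) powr (\<delta> - 1 / \<mu>)) \<and>
       nn_riesz \<alpha> (\<lambda>y. ennreal (b y powr r * enn2real (P y) powr \<theta>)) x
         \<le> ennreal (C * enn2real (P x) powr (\<delta> * (r - 1))))"
proof -
  define D where "D = real DIM('a)"
  define \<omega> where "\<omega> = unit_ball_vol D"
  have \<omega>: "0 < \<omega>" by (simp add: \<omega>_def D_def)
  have p: "1 < p" using r by simp
  have \<alpha>\<mu>: "\<alpha> * \<mu> = \<alpha> * p - \<gamma>" using \<alpha> by (simp add: \<mu>_def field_simps)
  have \<gamma>\<alpha>p: "\<gamma> < \<alpha> * p"
    using \<alpha> \<gamma> p by (smt (verit) mult_less_cancel_left2)
  have \<theta>0: "0 < \<theta>" using \<delta> r by (simp add: \<theta>_def)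
  have \<delta>0: "0 < \<delta>"
    using \<delta>(1) \<gamma>(3) by (smt (verit) divide_pos_pos)
  have rp: "0 < r / p" "r / p < 1" using r p by auto
  have \<gamma>D: "\<gamma> < DIM('a)" using \<alpha> \<gamma> by simp
  obtain C1 where C1: "0 < C1" and self: "\<And>(g::'a \<Rightarrow> ennreal) x \<rho>. g \<in> borel_measurable borel \<Longrightarrow> 0 < \<rho> \<Longrightarrow>
     (\<integral>\<^sup>+y\<in>ball x \<rho>. nn_riesz \<gamma> g y \<partial>lborel) \<le> ennreal (C1 * \<rho> powr D) * nn_riesz \<gamma> g x"
    using nn_riesz_ball_average_le_self[OF \<gamma>(1) \<gamma>D] unfolding D_def by blast
  obtain C2 where C2: "0 < C2" and mor: "\<And>(g::'a \<Rightarrow> ennreal) K x \<rho>.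
     g \<in> borel_measurable borel \<Longrightarrow> 0 \<le> K \<Longrightarrow> 0 < \<rho> \<Longrightarrow>
     (\<forall>t>0. (\<integral>\<^sup>+y\<in>ball x t. g y \<partial>lborel) \<le> ennreal (K * t powr (D - \<alpha> * p))) \<Longrightarrow>
     (\<integral>\<^sup>+y\<in>ball x \<rho>. nn_riesz \<gamma> g y \<partial>lborel) \<le> ennreal (C2 * K * \<rho> powr (D + \<gamma> - \<alpha> * p))"
    using nn_riesz_ball_average_le_morrey[OF \<gamma>(1) \<gamma>D \<gamma>\<alpha>p] unfolding D_def by blast
  \<comment> \<open>One constant that dominates the measure of the unit ball and all averaging
    constants, so that \<open>L * t powr D\<close> can serve as the common \<open>m\<close> in
    Hoelder's inequality on balls.\<close>
  define L where "L = 1 + \<omega> + C1 + C2 * \<omega>"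
  have L: "1 \<le> L" "\<omega> \<le> L" "C1 \<le> L" "C2 * \<omega> \<le> L" "0 < L"
    using \<omega> C1 C2 by (auto simp: L_def add_pos_pos)
  \<comment> \<open>Averages of \<open>P powr \<delta>\<close> over balls of radius \<open>t\<close>
    around \<open>x\<close> are bounded independently of \<open>t\<close> and by order
    \<open>- c1\<close> in \<open>t\<close>; those of \<open>b powr r * P powr \<theta>\<close> by
    orders \<open>- a2\<close> and \<open>- c2\<close>. The inequalities
    \<open>0 < \<alpha> < c1\<close> and \<open>a2 < \<alpha> < c2\<close> are what the
    interpolation needs.\<close>
  define c1 where "c1 = (\<alpha> * p - \<gamma>) * \<delta>"
  define a2 where "a2 = \<gamma> * r / p"
  define c2 where "c2 = \<alpha> * r + (\<alpha> * p - \<gamma>) * \<theta>"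
  have c1: "\<alpha> < c1"
    using \<delta> \<alpha> \<gamma> unfolding c1_def \<alpha>\<mu>[symmetric] by (simp add: field_simps)
  have a2: "a2 < \<alpha>"
  proof -
    have "\<gamma> * (r / p) < \<gamma> * 1" using rp \<gamma> by (intro mult_strict_left_mono) auto
    then show ?thesis using \<gamma> by (simp add: a2_def)
  qed
  have c2: "\<alpha> < c2"
  proof -
    have "\<alpha> * 1 < \<alpha> * r" using r \<alpha> by (intro mult_strict_left_mono) auto
    moreover have "0 < (\<alpha> * p - \<gamma>) * \<theta>" using \<theta>0 \<gamma>\<alpha>p by simp
    ultimately show ?thesis by (simp add: c2_def)
  qed
  have e1: "\<delta> * ((c1 - \<alpha>) / (c1 - 0)) = \<delta> - 1 / \<mu>"
  proof -
    have "c1 = \<alpha> * \<mu> * \<delta>" by (simp add: c1_def \<alpha>\<mu>)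
    then show ?thesis using \<alpha> \<gamma> \<delta>0 by (simp add: field_simps)
  qed
  \<comment> \<open>The definition of \<theta> is made for this identity: it turns the interpolated
    exponent into \<open>r - 1\<close> times the exponent \<delta> of the first test
    function.\<close>
  have e2: "(r / p + \<theta>) * ((c2 - \<alpha>) / (c2 - a2)) = \<delta> * (r - 1)"
  proof -
    have "c2 - a2 = \<alpha> * \<mu> * (r / p + \<theta>)"
      using p by (simp add: c2_def a2_def \<alpha>\<mu> field_simps)
    moreover have "c2 - \<alpha> = \<alpha> * \<mu> * (\<delta> * (r - 1))"
      using \<gamma> by (simp add: c2_def \<alpha>\<mu>[symmetric] \<theta>_def field_simps)
    moreover have "r / p + \<theta> \<noteq> 0" using rp \<theta>0 by linarith
    ultimately show ?thesis using \<alpha> \<gamma> by simp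
  qed
  obtain E1 where E1: "0 < E1" and int1: "\<And>(g::'a \<Rightarrow> ennreal) x (K::real) Q. g \<in> borel_measurable borel \<Longrightarrow> 0 \<le> K \<Longrightarrow> 0 < Q \<Longrightarrow>
     (\<forall>t>0. (\<integral>\<^sup>+y\<in>ball x t. g y \<partial>lborel) \<le> ennreal (K * Q * t powr (D - 0))) \<Longrightarrow>
     (\<forall>t>0. (\<integral>\<^sup>+y\<in>ball x t. g y \<partial>lborel) \<le> ennreal (K * t powr (D - c1))) \<Longrightarrow>
     nn_riesz \<alpha> g x \<le> ennreal (E1 * K * Q powr ((c1 - \<alpha>) / (c1 - 0)))"
    using nn_riesz_interpolate[OF \<alpha>(1) c1 \<alpha>(2)] unfolding D_def by blast
  obtain E2 where E2: "0 < E2" and int2: "\<And>(g::'a \<Rightarrow> ennreal) x (K::real) Q. g \<in> borel_measurable borel \<Longrightarrow> 0 \<le> K \<Longrightarrow> 0 < Q \<Longrightarrow>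
     (\<forall>t>0. (\<integral>\<^sup>+y\<in>ball x t. g y \<partial>lborel) \<le> ennreal (K * Q * t powr (D - a2))) \<Longrightarrow>
     (\<forall>t>0. (\<integral>\<^sup>+y\<in>ball x t. g y \<partial>lborel) \<le> ennreal (K * t powr (D - c2))) \<Longrightarrow>
     nn_riesz \<alpha> g x \<le> ennreal (E2 * K * Q powr ((c2 - \<alpha>) / (c2 - a2)))"
    using nn_riesz_interpolate[OF a2 c2 \<alpha>(2)] unfolding D_def by blast
  define C where "C = (E1 + E2) * (3 * L)"
  show ?thesis
    unfolding Let_def
  proof (intro exI[of _ C] conjI allI impI)
    show "0 < C" using E1 E2 L by (simp add: C_def)
    fix b :: "'a \<Rightarrow> real" and x :: 'a
    assume b[measurable]: "b \<in> borel_measurable borel" and b0: "\<forall>y. 0 \<le> b y"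
      and M: "\<forall>t>0. \<forall>z. (\<integral>\<^sup>+y\<in>ball z t. ennreal (b y powr p) \<partial>lborel)
         \<le> ennreal (unit_ball_vol DIM('a) * t powr (DIM('a) - \<alpha> * p))"
    define P where "P = nn_riesz \<gamma> (\<lambda>y. ennreal (b y powr p))"
    define u where "u y = enn2real (P y)" for y
    have [measurable]: "P \<in> borel_measurable borel" unfolding P_def by measurable
    have [measurable]: "u \<in> borel_measurable borel" unfolding u_def[abs_def] by measurable
    assume "0 < nn_riesz \<gamma> (\<lambda>y. ennreal (b y powr p)) x" "nn_riesz \<gamma> (\<lambda>y. ennreal (b y powr p)) x < \<infinity>"
    then have Pu: "P x = ennreal (u x)" and ux: "0 < u x"
      by (auto simp: u_def P_def enn2real_positive_iff)
    have u0: "0 \<le> u y" for y by (simp add: u_def)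
    \<comment> \<open>This rewrites a bound \<open>X * t powr e\<close> as an average bound \<beta>
      times the common \<open>m\<close>.\<close>
    have scale: "ennreal (X * t powr e) \<le> ennreal (\<beta> * (L * t powr D))"
      if "X \<le> L * k" "\<beta> = k * t powr (e - D)" "0 < t" for X t e \<beta> k
    proof (rule ennreal_leI)
      have "X * t powr e \<le> (L * k) * t powr e"
        using that by (intro mult_right_mono) auto
      also have "\<dots> = \<beta> * (L * t powr D)"
        using that by (simp add: powr_diff)
      finally show "X * t powr e \<le> \<beta> * (L * t powr D)" .
    qed
    have ball: "emeasure lborel (ball x t) \<le> ennreal (L * t powr D)" if "0 < t" for t
      using that L by (auto simp: emeasure_ball_powr \<omega>_def D_def intro!: ennreal_leI mult_right_mono)
    have b1: "(\<integral>\<^sup>+y\<in>ball x t. ennreal (b y powr p) \<partial>lborel)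
                \<le> ennreal ((u x * t powr (- \<gamma>)) * (L * t powr D))" if t: "0 < t" for t
    proof -
      have "(\<integral>\<^sup>+y\<in>ball x t. ennreal (b y powr p) \<partial>lborel) \<le> ennreal (t powr (D - \<gamma>)) * P x"
        unfolding P_def D_def using t \<gamma>D by (intro nn_integral_ball_le_nn_riesz) auto
      also have "\<dots> = ennreal (u x * t powr (D - \<gamma>))"
        using ux by (simp add: Pu mult.commute flip: ennreal_mult)
      also have "\<dots> \<le> ennreal ((u x * t powr (- \<gamma>)) * (L * t powr D))"
        using L ux t by (intro scale[where k = "u x"]) auto
      finally show ?thesis .
    qed
    have b2: "(\<integral>\<^sup>+y\<in>ball x t. ennreal (b y powr p) \<partial>lborel)
                \<le> ennreal (t powr (- \<alpha> * p) * (L * t powr D))" if t: "0 < t" for t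
    proof -
      have "(\<integral>\<^sup>+y\<in>ball x t. ennreal (b y powr p) \<partial>lborel) \<le> ennreal (\<omega> * t powr (D - \<alpha> * p))"
        using M t by (simp add: \<omega>_def D_def)
      also have "\<dots> \<le> ennreal (t powr (- \<alpha> * p) * (L * t powr D))"
        using L t by (intro scale[where k = 1]) auto
      finally show ?thesis .
    qed
    \<comment> \<open>Points where \<open>P\<close> is infinite do no harm, since \<open>u\<close>
      is 0 there.\<close>
    have uP: "(\<integral>\<^sup>+y\<in>ball x t. ennreal (u y) \<partial>lborel) \<le> (\<integral>\<^sup>+y\<in>ball x t. P y \<partial>lborel)" for t
      by (intro nn_integral_mono mult_right_mono) (auto simp: u_def ennreal_enn2real_le)
    have u1: "(\<integral>\<^sup>+y\<in>ball x t. ennreal (u y) \<partial>lborel) \<le> ennreal (u x * (L * t powr D))" if t: "0 < t" for t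
    proof -
      note uP[of t]
      also have "(\<integral>\<^sup>+y\<in>ball x t. P y \<partial>lborel) \<le> ennreal (C1 * t powr D) * P x"
        unfolding P_def using t by (intro self) auto
      also have "\<dots> = ennreal ((C1 * u x) * t powr D)"
        using ux C1 by (simp add: Pu mult_ac flip: ennreal_mult)
      also have "\<dots> \<le> ennreal (u x * (L * t powr D))"
        using L ux t by (intro scale[where k = "u x"]) auto
      finally show ?thesis .
    qed
    have u2: "(\<integral>\<^sup>+y\<in>ball x t. ennreal (u y) \<partial>lborel)
                \<le> ennreal (t powr (\<gamma> - \<alpha> * p) * (L * t powr D))" if t: "0 < t" for t
    proof -
      note uP[of t]
      also have "(\<integral>\<^sup>+y\<in>ball x t. P y \<partial>lborel) \<le> ennreal (C2 * \<omega> * t powr (D + \<gamma> - \<alpha> * p))"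
        unfolding P_def using t M \<omega> by (intro mor) (auto simp: \<omega>_def D_def)
      also have "\<dots> \<le> ennreal (t powr (\<gamma> - \<alpha> * p) * (L * t powr D))"
        using L t by (intro scale[where k = 1]) auto
      finally show ?thesis .
    qed
    have L0: "0 \<le> L * t powr D" for t using L by simp
    have ubound: "(\<integral>\<^sup>+y\<in>ball x t. ennreal (u y powr \<delta>) \<partial>lborel) \<le> ennreal (3 * \<pi> powr \<delta> * (L * t powr D))"
      if t: "0 < t" and "0 < \<pi>"
        and "(\<integral>\<^sup>+y\<in>ball x t. ennreal (u y) \<partial>lborel) \<le> ennreal (\<pi> * (L * t powr D))" for t \<pi>
    proof -
      \<comment> \<open>The second function in Hoelder's inequality is the constant 1, with exponent
        \<open>1 - \<delta>\<close>.\<close>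
      have "(\<integral>\<^sup>+y\<in>ball x t. ennreal (u y powr \<delta> * 1 powr (1 - \<delta>)) \<partial>lborel)
          \<le> ennreal (3 * \<pi> powr \<delta> * 1 powr (1 - \<delta>) * (L * t powr D))"
        using that ball[OF t] u0 L0[of t] \<delta> \<delta>0 by (intro nn_integral_powr_mult_powr_le) auto
      then show ?thesis by simp
    qed
    have bbound: "(\<integral>\<^sup>+y\<in>ball x t. ennreal (b y powr r * u y powr \<theta>) \<partial>lborel)
           \<le> ennreal (3 * \<beta> powr (r / p) * \<pi> powr \<theta> * (L * t powr D))"
      if t: "0 < t" and "0 < \<pi>" "0 < \<beta>"
        and "(\<integral>\<^sup>+y\<in>ball x t. ennreal (b y powr p) \<partial>lborel) \<le> ennreal (\<beta> * (L * t powr D))"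
        and "(\<integral>\<^sup>+y\<in>ball x t. ennreal (u y) \<partial>lborel) \<le> ennreal (\<pi> * (L * t powr D))" for t \<pi> \<beta>
    proof -
      \<comment> \<open>Only the averages of \<open>b powr p\<close> are controlled, so
        \<open>b powr r\<close> is read as its power \<open>r / p\<close>.\<close>
      have "(\<integral>\<^sup>+y\<in>ball x t. ennreal ((b y powr p) powr (r / p) * u y powr \<theta>) \<partial>lborel)
           \<le> ennreal (3 * \<beta> powr (r / p) * \<pi> powr \<theta> * (L * t powr D))"
        using that ball[OF t] u0 L0[of t] \<theta> \<theta>0 rp by (intro nn_integral_powr_mult_powr_le) auto
      then show ?thesis using p by (simp add: powr_powr)
    qed
    \<comment> \<open>Interpolation with \<open>K = 3 * L\<close> and
      \<open>Q = u x powr \<delta>\<close>; the bounds \<open>u1\<close> and \<open>u2\<close> serve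
      the small and the large scales.\<close>
    have "nn_riesz \<alpha> (\<lambda>y. ennreal (u y powr \<delta>)) x
        \<le> ennreal (E1 * (3 * L) * (u x powr \<delta>) powr ((c1 - \<alpha>) / (c1 - 0)))"
    proof (intro int1 allI impI)
      fix t :: real assume t: "0 < t"
      show "(\<integral>\<^sup>+y\<in>ball x t. ennreal (u y powr \<delta>) \<partial>lborel) \<le> ennreal (3 * L * u x powr \<delta> * t powr (D - 0))"
        using ubound[OF t ux u1[OF t]] by (simp add: mult_ac)
      have "t powr (D - c1) = (t powr (\<gamma> - \<alpha> * p)) powr \<delta> * t powr D"
        by (simp add: powr_powr c1_def algebra_simps flip: powr_add)
      then show "(\<integral>\<^sup>+y\<in>ball x t. ennreal (u y powr \<delta>) \<partial>lborel) \<le> ennreal (3 * L * t powr (D - c1))"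
        using ubound[OF t _ u2[OF t]] t by (simp add: mult_ac)
    qed (use L ux in auto)
    also have "(u x powr \<delta>) powr ((c1 - \<alpha>) / (c1 - 0)) = u x powr (\<delta> - 1 / \<mu>)"
      by (simp only: powr_powr e1)
    also have "ennreal (E1 * (3 * L) * u x powr (\<delta> - 1 / \<mu>)) \<le> ennreal (C * u x powr (\<delta> - 1 / \<mu>))"
      using E1 E2 L by (intro ennreal_leI mult_right_mono) (auto simp: C_def)
    finally show "nn_riesz \<alpha> (\<lambda>y. ennreal (enn2real (nn_riesz \<gamma> (\<lambda>y. ennreal (b y powr p)) y) powr \<delta>)) x
         \<le> ennreal (C * enn2real (nn_riesz \<gamma> (\<lambda>y. ennreal (b y powr p)) x) powr (\<delta> - 1 / \<mu>))"
      by (simp add: u_def P_def)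
    \<comment> \<open>Interpolation with \<open>Q = u x powr (r / p + \<theta>)\<close>; the bounds
      \<open>b1\<close> and \<open>u1\<close> serve the small scales, \<open>b2\<close> and
      \<open>u2\<close> the large ones.\<close>
    have "nn_riesz \<alpha> (\<lambda>y. ennreal (b y powr r * u y powr \<theta>)) x
        \<le> ennreal (E2 * (3 * L) * (u x powr (r / p + \<theta>)) powr ((c2 - \<alpha>) / (c2 - a2)))"
    proof (intro int2 allI impI)
      fix t :: real assume t: "0 < t"
      have "u x powr (r / p + \<theta>) * t powr (D - a2)
          = (u x * t powr (- \<gamma>)) powr (r / p) * u x powr \<theta> * t powr D"
      proof -
        have "(u x * t powr (- \<gamma>)) powr (r / p) = u x powr (r / p) * t powr (- a2)"
          using ux by (simp add: powr_mult powr_powr a2_def)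
        then show ?thesis
          by (simp add: powr_add powr_diff powr_minus field_simps)
      qed
      then show "(\<integral>\<^sup>+y\<in>ball x t. ennreal (b y powr r * u y powr \<theta>) \<partial>lborel)
             \<le> ennreal (3 * L * u x powr (r / p + \<theta>) * t powr (D - a2))"
        using bbound[OF t ux _ b1[OF t] u1[OF t]] t ux by (simp add: mult_ac)
      have "t powr (D - c2) = t powr ((- \<alpha> * p) * (r / p) + (\<gamma> - \<alpha> * p) * \<theta> + D)"
        using p by (simp add: c2_def algebra_simps)
      also have "\<dots> = (t powr (- \<alpha> * p)) powr (r / p) * (t powr (\<gamma> - \<alpha> * p)) powr \<theta> * t powr D"
        by (simp only: powr_powr powr_add)
      finally show "(\<integral>\<^sup>+y\<in>ball x t. ennreal (b y powr r * u y powr \<theta>) \<partial>lborel) \<le> ennreal (3 * L * t powr (D - c2))"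
        using bbound[OF t _ _ b2[OF t] u2[OF t]] t by (simp add: mult_ac)
    qed (use L ux in auto)
    also have "(u x powr (r / p + \<theta>)) powr ((c2 - \<alpha>) / (c2 - a2)) = u x powr (\<delta> * (r - 1))"
      by (simp only: powr_powr e2)
    also have "ennreal (E2 * (3 * L) * u x powr (\<delta> * (r - 1))) \<le> ennreal (C * u x powr (\<delta> * (r - 1)))"
      using E1 E2 L by (intro ennreal_leI mult_right_mono) (auto simp: C_def)
    finally show "nn_riesz \<alpha> (\<lambda>y. ennreal (b y powr r * enn2real (nn_riesz \<gamma> (\<lambda>y. ennreal (b y powr p)) y) powr \<theta>)) x
         \<le> ennreal (C * enn2real (nn_riesz \<gamma> (\<lambda>y. ennreal (b y powr p)) x) powr (\<delta> * (r - 1)))"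
      by (simp add: u_def P_def)
  qed
qed

section \<open>Schur's test and the trace inequality\<close>

text \<open>With \<open>h = f powr r * \<phi> powr (1 - r)\<close> one has
  \<open>f = h powr (1 / r) * \<phi> powr (1 - 1 / r)\<close> where \<phi> is positive. Young's
  inequality for \<open>h / \<xi>\<close> and \<open>\<phi> / m\<close> then gives Hoelder's
  inequality for the measure with density \<open>k\<close>.\<close>

lemma nn_integral_Holder_weighted:
  fixes k :: "'a \<Rightarrow> ennreal" and f \<phi> :: "'a \<Rightarrow> real" and r m \<xi> :: real
  assumes [measurable]: "k \<in> borel_measurable M" "f \<in> borel_measurable M" "\<phi> \<in> borel_measurable M"
    and r: "1 < r" and f: "\<And>y. 0 \<le> f y" and \<phi>: "AE y in M. 0 < \<phi> y" and pos: "0 < m" "0 < \<xi>"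
    and m: "(\<integral>\<^sup>+y. k y * ennreal (\<phi> y) \<partial>M) \<le> ennreal m"
    and \<xi>: "(\<integral>\<^sup>+y. k y * ennreal (f y powr r * \<phi> y powr (1 - r)) \<partial>M) \<le> ennreal \<xi>"
  shows "(\<integral>\<^sup>+y. k y * ennreal (f y) \<partial>M) \<le> ennreal (2 * (\<xi> powr (1 / r) * m powr (1 - 1 / r)))"
proof -
  define c where "c = \<xi> powr (1 / r) * m powr (1 - 1 / r)"
  have c: "0 < c" using pos by (simp add: c_def)
  define h where "h y = f y powr r * \<phi> y powr (1 - r)" for y
  have h0: "0 \<le> h y" for y by (simp add: h_def)
  have [measurable]: "h \<in> borel_measurable M" unfolding h_def[abs_def] by measurable
  have pw: "f y \<le> c / \<xi> * h y + c / m * \<phi> y" if "0 < \<phi> y" for y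
  proof (cases "f y = 0")
    case True
    then show ?thesis using that c pos by (simp add: h_def)
  next
    case False
    then have fy: "0 < f y" using f[of y] by simp
    then have hy: "0 < h y" using that by (simp add: h_def)
    have "h y powr (1 / r) * \<phi> y powr (1 - 1 / r) = f y * \<phi> y powr ((1 - r) * (1 / r) + (1 - 1 / r))"
      using fy that r by (simp add: h_def powr_mult powr_powr powr_add)
    also have "(1 - r) * (1 / r) + (1 - 1 / r) = 0"
      using r by (simp add: field_simps)
    finally have "f y = h y powr (1 / r) * \<phi> y powr (1 - 1 / r)"
      using that by simp
    also have "\<dots> = c * ((h y / \<xi>) powr (1 / r) * (\<phi> y / m) powr (1 - 1 / r))"
      using pos by (simp add: c_def powr_divide)
    also have "\<dots> \<le> c * (1 / r * (h y / \<xi>) + (1 - 1 / r) * (\<phi> y / m))"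
      using c pos hy that r by (intro mult_left_mono Youngs_inequality_0) auto
    \<comment> \<open>Replacing both Young weights by 1 is the source of the factor 2.\<close>
    also have "\<dots> \<le> c * (1 * (h y / \<xi>) + 1 * (\<phi> y / m))"
      using c pos hy that r by (intro mult_left_mono add_mono mult_right_mono) auto
    finally show ?thesis by (simp add: algebra_simps)
  qed
  have "(\<integral>\<^sup>+y. k y * ennreal (f y) \<partial>M)
      \<le> (\<integral>\<^sup>+y. ennreal (c / \<xi>) * (k y * ennreal (h y)) + ennreal (c / m) * (k y * ennreal (\<phi> y)) \<partial>M)"
    using \<phi>
  proof (intro nn_integral_mono_AE, eventually_elim)
    case (elim y)
    have "k y * ennreal (f y) \<le> k y * ennreal (c / \<xi> * h y + c / m * \<phi> y)"
      by (intro mult_left_mono ennreal_leI pw elim) auto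
    also have "\<dots> = ennreal (c / \<xi>) * (k y * ennreal (h y)) + ennreal (c / m) * (k y * ennreal (\<phi> y))"
    proof -
      have "ennreal (c / \<xi> * h y + c / m * \<phi> y)
          = ennreal (c / \<xi>) * ennreal (h y) + ennreal (c / m) * ennreal (\<phi> y)"
        using elim c pos h0[of y] by (simp flip: ennreal_mult ennreal_plus)
      then show ?thesis by (simp add: distrib_left mult_ac)
    qed
    finally show ?case .
  qed
  also have "\<dots> = ennreal (c / \<xi>) * (\<integral>\<^sup>+y. k y * ennreal (h y) \<partial>M) + ennreal (c / m) * (\<integral>\<^sup>+y. k y * ennreal (\<phi> y) \<partial>M)"
    by (simp add: nn_integral_add nn_integral_cmult)
  also have "\<dots> \<le> ennreal (c / \<xi>) * ennreal \<xi> + ennreal (c / m) * ennreal m"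
    unfolding h_def by (intro add_mono mult_left_mono \<xi> m) auto
  also have "\<dots> = ennreal (2 * c)"
    using c pos by (simp flip: ennreal_mult ennreal_plus)
  finally show ?thesis by (simp add: c_def)
qed

text \<open>After taking the power \<open>r\<close>, the bound is linear in the weighted integral,
  so that it can be integrated once more by Tonelli. Finiteness is a separate conclusion because
  \<open>enn2real\<close> sends an infinite integral to 0.\<close>

lemma nn_integral_Holder_weighted_powr:
  fixes k :: "'a \<Rightarrow> ennreal" and f \<phi> :: "'a \<Rightarrow> real" and r m :: real
  assumes [measurable]: "k \<in> borel_measurable M" "f \<in> borel_measurable M" "\<phi> \<in> borel_measurable M"
    and r: "1 < r" and f: "\<And>y. 0 \<le> f y" and \<phi>: "AE y in M. 0 < \<phi> y" and pos: "0 < m"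
    and m: "(\<integral>\<^sup>+y. k y * ennreal (\<phi> y) \<partial>M) \<le> ennreal m"
    and fin: "(\<integral>\<^sup>+y. k y * ennreal (f y powr r * \<phi> y powr (1 - r)) \<partial>M) < \<infinity>"
  shows "(\<integral>\<^sup>+y. k y * ennreal (f y) \<partial>M) < \<infinity>"
    and "ennreal (enn2real (\<integral>\<^sup>+y. k y * ennreal (f y) \<partial>M) powr r)
           \<le> ennreal (2 powr r * m powr (r - 1)) * (\<integral>\<^sup>+y. k y * ennreal (f y powr r * \<phi> y powr (1 - r)) \<partial>M)"
proof -
  define X where "X = (\<integral>\<^sup>+y. k y * ennreal (f y powr r * \<phi> y powr (1 - r)) \<partial>M)"
  define I where "I = (\<integral>\<^sup>+y. k y * ennreal (f y) \<partial>M)"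
  have "I < \<infinity> \<and> ennreal (enn2real I powr r) \<le> ennreal (2 powr r * m powr (r - 1)) * X"
  proof (cases "X = 0")
    \<comment> \<open>Normalising by \<xi> is impossible here; instead the weighted integrand
      vanishes almost everywhere, and with it \<open>k * f\<close>.\<close>
    case True
    then have "AE y in M. k y * ennreal (f y powr r * \<phi> y powr (1 - r)) = 0"
      unfolding X_def by (subst (asm) nn_integral_0_iff_AE) auto
    then have "AE y in M. k y * ennreal (f y) = 0"
      using \<phi>
    proof eventually_elim
      case (elim y)
      then show ?case using f[of y] by (auto simp: ennreal_eq_0_iff mult_le_0_iff)
    qed
    then have "I = 0"
      unfolding I_def by (subst nn_integral_0_iff_AE) auto
    then show ?thesis by simp
  next
    case False
    define \<xi> where "\<xi> = enn2real X"
    have \<xi>: "X = ennreal \<xi>" "0 < \<xi>"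
      using False fin by (auto simp: \<xi>_def X_def[symmetric] enn2real_positive_iff zero_less_iff_neq_zero)
    have I: "I \<le> ennreal (2 * (\<xi> powr (1 / r) * m powr (1 - 1 / r)))"
      unfolding I_def using \<xi> m
      by (intro nn_integral_Holder_weighted[where \<phi> = \<phi>] r f \<phi> pos) (auto simp: X_def)
    then have fin: "I < \<infinity>"
      by (simp add: order_le_less_trans)
    have "enn2real I \<le> 2 * (\<xi> powr (1 / r) * m powr (1 - 1 / r))"
      using I by (intro enn2real_leI) auto
    then have "enn2real I powr r \<le> (2 * (\<xi> powr (1 / r) * m powr (1 - 1 / r))) powr r"
      using r by (intro powr_mono2) auto
    also have "\<dots> = 2 powr r * \<xi> * m powr ((1 - 1 / r) * r)"
      using r \<xi> by (simp add: powr_mult powr_powr)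
    also have "(1 - 1 / r) * r = r - 1"
      using r by (simp add: field_simps)
    finally have "ennreal (enn2real I powr r) \<le> ennreal (2 powr r * \<xi> * m powr (r - 1))"
      by (rule ennreal_leI)
    also have "\<dots> = ennreal (2 powr r * m powr (r - 1)) * X"
      using \<xi> by (simp add: mult_ac flip: ennreal_mult)
    finally show ?thesis using fin by simp
  qed
  then show "(\<integral>\<^sup>+y. k y * ennreal (f y) \<partial>M) < \<infinity>"
    and "ennreal (enn2real (\<integral>\<^sup>+y. k y * ennreal (f y) \<partial>M) powr r)
           \<le> ennreal (2 powr r * m powr (r - 1)) * (\<integral>\<^sup>+y. k y * ennreal (f y powr r * \<phi> y powr (1 - r)) \<partial>M)"
    by (simp_all add: I_def X_def)
qed

lemma nn_riesz_symmetric: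
  fixes g h :: "'a::euclidean_space \<Rightarrow> ennreal"
  assumes [measurable]: "g \<in> borel_measurable borel" "h \<in> borel_measurable borel"
  shows "(\<integral>\<^sup>+x. g x * nn_riesz \<kappa> h x \<partial>lborel) = (\<integral>\<^sup>+y. h y * nn_riesz \<kappa> g y \<partial>lborel)"
proof -
  have "(\<integral>\<^sup>+x. g x * nn_riesz \<kappa> h x \<partial>lborel)
      = (\<integral>\<^sup>+x. \<integral>\<^sup>+y. g x * (ennreal (riesz_kernel \<kappa> (y - x)) * h y) \<partial>lborel \<partial>lborel)"
    by (simp add: nn_riesz_def nn_integral_cmult)
  also have "\<dots> = (\<integral>\<^sup>+y. \<integral>\<^sup>+x. g x * (ennreal (riesz_kernel \<kappa> (y - x)) * h y) \<partial>lborel \<partial>lborel)"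
    by (rule lborel_pair.Fubini') measurable
  also have "\<dots> = (\<integral>\<^sup>+y. \<integral>\<^sup>+x. h y * (ennreal (riesz_kernel \<kappa> (x - y)) * g x) \<partial>lborel \<partial>lborel)"
    by (intro nn_integral_cong) (simp add: riesz_kernel_minus_commute mult_ac)
  also have "\<dots> = (\<integral>\<^sup>+y. h y * nn_riesz \<kappa> g y \<partial>lborel)"
    by (simp add: nn_riesz_def nn_integral_cmult)
  finally show ?thesis .
qed

text \<open>Hoelder bounds the power \<open>r\<close> of the potential \<open>I\<close> of
  \<open>f\<close> by a constant times \<open>\<psi> powr (r - 1) * X\<close>, where
  \<open>X\<close> is the potential of \<open>f powr r * \<phi> powr (1 - r)\<close>. Moving the
  operator onto \<open>w * \<psi> powr (r - 1)\<close> by symmetry, the second condition produces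
  \<open>\<phi> powr (r - 1)\<close>, which cancels the negative power of \<phi>.\<close>

lemma nn_riesz_schur_test:
  fixes f \<phi> \<psi> w :: "'a::euclidean_space \<Rightarrow> real" and \<alpha> r C :: real
  assumes [measurable]: "f \<in> borel_measurable borel" "\<phi> \<in> borel_measurable borel"
      "\<psi> \<in> borel_measurable borel" "w \<in> borel_measurable borel"
    and f: "\<And>x. 0 \<le> f x" and w: "\<And>x. 0 \<le> w x" and r: "1 < r" and C: "0 < C"
    and \<phi>: "AE x in lborel. 0 < \<phi> x" and \<psi>: "AE x in lborel. 0 < \<psi> x"
    and \<phi>\<psi>: "AE x in lborel. nn_riesz \<alpha> (\<lambda>y. ennreal (\<phi> y)) x \<le> ennreal (C * \<psi> x)"
    and \<psi>\<phi>: "AE x in lborel. nn_riesz \<alpha> (\<lambda>y. ennreal (w y * \<psi> y powr (r - 1))) x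
                \<le> ennreal (C * \<phi> x powr (r - 1))"
    and fin: "(\<integral>\<^sup>+x. ennreal (f x powr r) \<partial>lborel) < \<infinity>"
  shows "AE x in lborel. w x \<noteq> 0 \<longrightarrow> nn_riesz \<alpha> (\<lambda>y. ennreal (f y)) x < \<infinity>"
    and "(\<integral>\<^sup>+x. ennreal (w x * enn2real (nn_riesz \<alpha> (\<lambda>y. ennreal (f y)) x) powr r) \<partial>lborel)
           \<le> ennreal ((2 * C) powr r) * (\<integral>\<^sup>+x. ennreal (f x powr r) \<partial>lborel)"
proof -
  define h where "h y = f y powr r * \<phi> y powr (1 - r)" for y
  define I where "I = nn_riesz \<alpha> (\<lambda>y. ennreal (f y))"
  define X where "X = nn_riesz \<alpha> (\<lambda>y. ennreal (h y))"
  define v where "v x = w x * \<psi> x powr (r - 1)" for x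
  have [measurable]: "h \<in> borel_measurable borel" "v \<in> borel_measurable borel"
    unfolding h_def[abs_def] v_def[abs_def] by measurable
  have [measurable]: "X \<in> borel_measurable borel" unfolding X_def by measurable
  have holder: "AE x in lborel. X x < \<infinity> \<longrightarrow> I x < \<infinity> \<and>
      ennreal (enn2real (I x) powr r) \<le> ennreal (2 powr r * (C * \<psi> x) powr (r - 1)) * X x"
    using \<psi> \<phi>\<psi>
  proof eventually_elim
    case (elim x)
    have "0 < C * \<psi> x" using elim C by simp
    note H = nn_integral_Holder_weighted_powr[OF _ _ _ r f \<phi> this,
        of "\<lambda>y. ennreal (riesz_kernel \<alpha> (y - x))"]
    show ?case
      using H elim by (auto simp: I_def X_def nn_riesz_def h_def)
  qed
  have vX: "(\<integral>\<^sup>+x. ennreal (v x) * X x \<partial>lborel) \<le> ennreal C * (\<integral>\<^sup>+x. ennreal (f x powr r) \<partial>lborel)"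
  proof -
    have "(\<integral>\<^sup>+x. ennreal (v x) * X x \<partial>lborel)
        = (\<integral>\<^sup>+y. ennreal (h y) * nn_riesz \<alpha> (\<lambda>x. ennreal (v x)) y \<partial>lborel)"
      unfolding X_def by (rule nn_riesz_symmetric) measurable
    also have "\<dots> \<le> (\<integral>\<^sup>+y. ennreal C * ennreal (f y powr r) \<partial>lborel)"
      using \<psi>\<phi> \<phi>
    proof (intro nn_integral_mono_AE, eventually_elim)
      case (elim y)
      have "ennreal (h y) * nn_riesz \<alpha> (\<lambda>x. ennreal (v x)) y
          \<le> ennreal (h y) * ennreal (C * \<phi> y powr (r - 1))"
        unfolding v_def by (intro mult_left_mono elim) auto
      also have "\<dots> = ennreal (h y * (C * \<phi> y powr (r - 1)))"
        using C by (intro ennreal_mult[symmetric]) (auto simp: h_def)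
      also have "h y * (C * \<phi> y powr (r - 1)) = C * f y powr r * \<phi> y powr ((1 - r) + (r - 1))"
        by (simp only: powr_add h_def mult_ac)
      also have "\<dots> = C * f y powr r"
        using elim by simp
      finally show ?case
        using C by (simp add: ennreal_mult)
    qed
    also have "\<dots> = ennreal C * (\<integral>\<^sup>+x. ennreal (f x powr r) \<partial>lborel)"
      by (intro nn_integral_cmult) measurable
    finally show ?thesis .
  qed
  \<comment> \<open>Finiteness of this integral forces \<open>X\<close> to be finite almost
    everywhere on the set where \<open>w\<close> is nonzero, which discharges the premise of
    \<open>holder\<close> there.\<close>
  have "(\<integral>\<^sup>+x. ennreal (v x) * X x \<partial>lborel) < \<infinity>"
    using vX fin C by (metis ennreal_mult_less_top ennreal_less_top infinity_ennreal_def order_le_less_trans)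
  then have "AE x in lborel. ennreal (v x) * X x \<noteq> \<infinity>"
    by (intro nn_integral_PInf_AE) auto
  then have Xfin: "AE x in lborel. w x \<noteq> 0 \<longrightarrow> X x < \<infinity>"
    using \<psi>
  proof eventually_elim
    case (elim x)
    show ?case
    proof
      assume "w x \<noteq> 0"
      then have "0 < v x" using w[of x] elim by (simp add: v_def)
      then show "X x < \<infinity>" using elim
        by (auto simp: ennreal_mult_eq_top_iff less_top)
    qed
  qed
  then show "AE x in lborel. w x \<noteq> 0 \<longrightarrow> nn_riesz \<alpha> (\<lambda>y. ennreal (f y)) x < \<infinity>"
    using holder unfolding I_def[symmetric] by eventually_elim auto
  have "(\<integral>\<^sup>+x. ennreal (w x * enn2real (I x) powr r) \<partial>lborel)
      \<le> (\<integral>\<^sup>+x. ennreal (2 powr r * C powr (r - 1)) * (ennreal (v x) * X x) \<partial>lborel)"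
    using Xfin holder \<psi>
  proof (intro nn_integral_mono_AE, eventually_elim)
    case (elim x)
    show ?case
    proof (cases "w x = 0")
      case False
      have "ennreal (w x * enn2real (I x) powr r) = ennreal (w x) * ennreal (enn2real (I x) powr r)"
        using w by (simp add: ennreal_mult)
      also have "\<dots> \<le> ennreal (w x) * (ennreal (2 powr r * (C * \<psi> x) powr (r - 1)) * X x)"
        using False elim by (intro mult_left_mono) auto
      also have "\<dots> = ennreal (2 powr r * C powr (r - 1)) * (ennreal (v x) * X x)"
        using w elim C by (simp add: v_def powr_mult ennreal_mult mult_ac)
      finally show ?thesis .
    qed simp
  qed
  also have "\<dots> = ennreal (2 powr r * C powr (r - 1)) * (\<integral>\<^sup>+x. ennreal (v x) * X x \<partial>lborel)"
    by (intro nn_integral_cmult) measurable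
  also have "\<dots> \<le> ennreal (2 powr r * C powr (r - 1)) * (ennreal C * (\<integral>\<^sup>+x. ennreal (f x powr r) \<partial>lborel))"
    by (intro mult_left_mono vX) auto
  also have "\<dots> = ennreal ((2 * C) powr r) * (\<integral>\<^sup>+x. ennreal (f x powr r) \<partial>lborel)"
    using C by (simp add: powr_mult powr_diff flip: mult.assoc ennreal_mult)
  finally show "(\<integral>\<^sup>+x. ennreal (w x * enn2real (nn_riesz \<alpha> (\<lambda>y. ennreal (f y)) x) powr r) \<partial>lborel)
           \<le> ennreal ((2 * C) powr r) * (\<integral>\<^sup>+x. ennreal (f x powr r) \<partial>lborel)"
    unfolding I_def .
qed

section \<open>Positivity and finiteness of potentials, choice of exponents\<close>

lemma nn_riesz_pos:
  fixes g :: "'a::euclidean_space \<Rightarrow> ennreal"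
  assumes [measurable]: "g \<in> borel_measurable borel" and "\<not> (AE y in lborel. g y = 0)"
  shows "0 < nn_riesz \<kappa> g x"
proof (rule ccontr)
  assume "\<not> 0 < nn_riesz \<kappa> g x"
  then have "(\<integral>\<^sup>+y. ennreal (riesz_kernel \<kappa> (y - x)) * g y \<partial>lborel) = 0"
    by (simp add: nn_riesz_def not_less)
  then have "AE y in lborel. ennreal (riesz_kernel \<kappa> (y - x)) * g y = 0"
    by (subst (asm) nn_integral_0_iff_AE) auto
  then have "AE y in lborel. g y = 0"
    using AE_lborel_singleton[of x]
    by eventually_elim (auto simp: riesz_kernel_def ennreal_eq_0_iff not_le[symmetric])
  with assms show False by simp
qed

text \<open>The Morrey bound makes the potential integrable over every ball, and countably many
  balls exhaust the space.\<close>

lemma nn_riesz_morrey_finite_AE: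
  fixes g :: "'a::euclidean_space \<Rightarrow> ennreal" and \<kappa> \<sigma> K :: real
  assumes [measurable]: "g \<in> borel_measurable borel"
    and "0 < \<kappa>" "\<kappa> < DIM('a)" "\<kappa> < \<sigma>" "0 \<le> K"
    and "\<forall>t>0. \<forall>z. (\<integral>\<^sup>+y\<in>ball z t. g y \<partial>lborel) \<le> ennreal (K * t powr (DIM('a) - \<sigma>))"
  shows "AE x in lborel. nn_riesz \<kappa> g x < \<infinity>"
proof -
  obtain C where C: "\<And>(g::'a \<Rightarrow> ennreal) K x \<rho>. g \<in> borel_measurable borel \<Longrightarrow> 0 \<le> K \<Longrightarrow> 0 < \<rho> \<Longrightarrow>
     (\<forall>t>0. (\<integral>\<^sup>+y\<in>ball x t. g y \<partial>lborel) \<le> ennreal (K * t powr (DIM('a) - \<sigma>))) \<Longrightarrow>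
     (\<integral>\<^sup>+y\<in>ball x \<rho>. nn_riesz \<kappa> g y \<partial>lborel) \<le> ennreal (C * K * \<rho> powr (DIM('a) + \<kappa> - \<sigma>))"
    using nn_riesz_ball_average_le_morrey[OF assms(2-4)] by blast
  have "AE x in lborel. \<forall>n::nat. nn_riesz \<kappa> g x * indicator (ball 0 (Suc n)) x \<noteq> \<infinity>"
    unfolding AE_all_countable
  proof (intro allI nn_integral_PInf_AE)
    fix n :: nat
    have "(\<integral>\<^sup>+y\<in>ball 0 (Suc n). nn_riesz \<kappa> g y \<partial>lborel) \<le> ennreal (C * K * real (Suc n) powr (DIM('a) + \<kappa> - \<sigma>))"
      using assms by (intro C) auto
    then show "(\<integral>\<^sup>+y\<in>ball 0 (Suc n). nn_riesz \<kappa> g y \<partial>lborel) \<noteq> \<infinity>"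
      by (auto simp: top_unique)
  qed (auto intro!: borel_measurable_times_ennreal borel_measurable_indicator)
  then show ?thesis
  proof eventually_elim
    case (elim x)
    obtain n where "norm x < real n" using reals_Archimedean2 by blast
    then have "x \<in> ball 0 (Suc n)" by simp
    then show ?case using elim[rule_format, of n] by (simp add: less_top)
  qed
qed

text \<open>The normalised Borel case: Schur's test with weight \<open>b powr r\<close> and powers
  of \<open>P\<close> as test functions. What remains is the choice of \<gamma> and \<delta> and the
  almost everywhere positivity and finiteness of \<open>P\<close>.\<close>

lemma nn_riesz_trace_inequality:
  fixes \<alpha> p r :: real
  assumes \<alpha>: "0 < \<alpha>" "\<alpha> < DIM('a::euclidean_space)" and r: "1 < r" "r < p"
  shows "\<exists>C>0. \<forall>b f :: 'a \<Rightarrow> real. b \<in> borel_measurable borel \<longrightarrow> (\<forall>y. 0 \<le> b y) \<longrightarrow>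
     (\<forall>t>0. \<forall>z. (\<integral>\<^sup>+y\<in>ball z t. ennreal (b y powr p) \<partial>lborel)
         \<le> ennreal (unit_ball_vol DIM('a) * t powr (DIM('a) - \<alpha> * p))) \<longrightarrow>
     f \<in> borel_measurable borel \<longrightarrow> (\<forall>y. 0 \<le> f y) \<longrightarrow>
     (\<integral>\<^sup>+x. ennreal (f x powr r) \<partial>lborel) < \<infinity> \<longrightarrow>
     (AE x in lborel. b x \<noteq> 0 \<longrightarrow> nn_riesz \<alpha> (\<lambda>y. ennreal (f y)) x < \<infinity>) \<and>
     (\<integral>\<^sup>+x. ennreal (b x powr r * enn2real (nn_riesz \<alpha> (\<lambda>y. ennreal (f y)) x) powr r) \<partial>lborel)
       \<le> ennreal C * (\<integral>\<^sup>+x. ennreal (f x powr r) \<partial>lborel)"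
proof -
  \<comment> \<open>The minimum and the factor 1/2 ensure both \<open>\<gamma> < \<alpha>\<close>
    and \<open>\<gamma> / \<alpha> < p - 1\<close>; the latter says
    \<open>1 < \<mu>\<close>.\<close>
  define \<gamma> where "\<gamma> = \<alpha> * min 1 (p - 1) / 2"
  define \<mu> where "\<mu> = p - \<gamma> / \<alpha>"
  \<comment> \<open>The largest exponent compatible with \<open>\<delta> \<le> 1\<close> and
    \<open>\<theta> \<le> 1 - r / p\<close>. It exceeds \<open>1 / \<mu>\<close> because
    \<open>r < p\<close>.\<close>
  define \<delta> where "\<delta> = 1 / \<mu> + min (1 - 1 / \<mu>) ((1 - r / p) / (r - 1))"
  define \<theta> where "\<theta> = (\<delta> - 1 / \<mu>) * (r - 1)"
  have p: "1 < p" using r by simp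
  have \<gamma>: "0 < \<gamma>" "\<gamma> < \<alpha>"
  proof -
    show "0 < \<gamma>" using \<alpha> p by (simp add: \<gamma>_def)
    have "\<alpha> * min 1 (p - 1) \<le> \<alpha> * 1" using \<alpha> by (intro mult_left_mono) auto
    then show "\<gamma> < \<alpha>" using \<alpha> by (simp add: \<gamma>_def)
  qed
  have \<mu>: "1 < \<mu>"
  proof -
    have "\<gamma> / \<alpha> = min 1 (p - 1) / 2" using \<alpha> by (simp add: \<gamma>_def)
    also have "\<dots> \<le> (p - 1) / 2" by (intro divide_right_mono) auto
    also have "\<dots> < p - 1" using p by simp
    finally show ?thesis by (simp add: \<mu>_def)
  qed
  have \<mu>1: "1 / \<mu> < 1" using \<mu> by simp
  have rp: "0 < 1 - r / p" using r p by simp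
  have \<delta>: "1 / \<mu> < \<delta>" "\<delta> \<le> 1"
    using \<mu>1 rp r by (auto simp: \<delta>_def)
  have "\<theta> \<le> (1 - r / p) / (r - 1) * (r - 1)"
    unfolding \<theta>_def \<delta>_def using r by (intro mult_right_mono) auto
  then have \<theta>: "\<theta> \<le> 1 - r / p" using r by simp
  have \<gamma>\<alpha>p: "\<gamma> < \<alpha> * p"
    using \<gamma> \<alpha> p by (smt (verit) mult_less_cancel_left2)
  obtain C where C: "0 < C" and test: "\<And>(b::'a \<Rightarrow> real) x. b \<in> borel_measurable borel \<Longrightarrow> (\<forall>y. 0 \<le> b y) \<Longrightarrow>
     (\<forall>t>0. \<forall>z. (\<integral>\<^sup>+y\<in>ball z t. ennreal (b y powr p) \<partial>lborel)
         \<le> ennreal (unit_ball_vol DIM('a) * t powr (DIM('a) - \<alpha> * p))) \<Longrightarrow>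
     (let P = nn_riesz \<gamma> (\<lambda>y. ennreal (b y powr p)) in
       0 < P x \<longrightarrow> P x < \<infinity> \<longrightarrow>
       nn_riesz \<alpha> (\<lambda>y. ennreal (enn2real (P y) powr \<delta>)) x
         \<le> ennreal (C * enn2real (P x) powr (\<delta> - 1 / \<mu>)) \<and>
       nn_riesz \<alpha> (\<lambda>y. ennreal (b y powr r * enn2real (P y) powr \<theta>)) x
         \<le> ennreal (C * enn2real (P x) powr (\<delta> * (r - 1))))"
    using nn_riesz_test_functions[OF \<alpha> r \<gamma> \<mu>[unfolded \<mu>_def] \<delta>[unfolded \<mu>_def] \<theta>[unfolded \<theta>_def \<mu>_def]]
    unfolding \<theta>_def[symmetric] \<mu>_def[symmetric] by blast
  show ?thesis
  proof (intro exI[of _ "(2 * C) powr r"] conjI[of "0 < (2 * C) powr r"] allI impI)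
    show "0 < (2 * C) powr r" using C by simp
    fix b f :: "'a \<Rightarrow> real"
    assume b[measurable]: "b \<in> borel_measurable borel" and b0: "\<forall>y. 0 \<le> b y"
      and M: "\<forall>t>0. \<forall>z. (\<integral>\<^sup>+y\<in>ball z t. ennreal (b y powr p) \<partial>lborel)
         \<le> ennreal (unit_ball_vol DIM('a) * t powr (DIM('a) - \<alpha> * p))"
      and f[measurable]: "f \<in> borel_measurable borel" and f0: "\<forall>y. 0 \<le> f y"
      and fin: "(\<integral>\<^sup>+x. ennreal (f x powr r) \<partial>lborel) < \<infinity>"
    show "(AE x in lborel. b x \<noteq> 0 \<longrightarrow> nn_riesz \<alpha> (\<lambda>y. ennreal (f y)) x < \<infinity>) \<and>
     (\<integral>\<^sup>+x. ennreal (b x powr r * enn2real (nn_riesz \<alpha> (\<lambda>y. ennreal (f y)) x) powr r) \<partial>lborel)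
       \<le> ennreal ((2 * C) powr r) * (\<integral>\<^sup>+x. ennreal (f x powr r) \<partial>lborel)"
    proof (cases "AE y in lborel. b y = 0")
      \<comment> \<open>If \<open>b\<close> vanishes almost everywhere, then \<open>P\<close>
        vanishes too and gives no positive test functions; both claims are then immediate.\<close>
      case True
      have "(\<integral>\<^sup>+x. ennreal (b x powr r * enn2real (nn_riesz \<alpha> (\<lambda>y. ennreal (f y)) x) powr r) \<partial>lborel) = (\<integral>\<^sup>+x. 0 \<partial>(lborel :: 'a measure))"
        by (intro nn_integral_cong_AE) (use True in eventually_elim, simp)
      then show ?thesis using True by (auto elim: eventually_mono)
    next
      case False
      define P where "P = nn_riesz \<gamma> (\<lambda>y. ennreal (b y powr p))"
      define u where "u y = enn2real (P y)" for y
      have [measurable]: "P \<in> borel_measurable borel" unfolding P_def by measurable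
      have [measurable]: "u \<in> borel_measurable borel" unfolding u_def[abs_def] by measurable
      have "\<not> (AE y in lborel. ennreal (b y powr p) = 0)"
        using False by (simp add: ennreal_eq_0_iff)
      then have P0: "0 < P x" for x unfolding P_def by (intro nn_riesz_pos) auto
      have Pfin: "AE x in lborel. P x < \<infinity>"
        unfolding P_def using \<gamma> \<alpha> \<gamma>\<alpha>p M
        by (intro nn_riesz_morrey_finite_AE[where \<sigma> = "\<alpha> * p" and K = "unit_ball_vol DIM('a)"]) auto
      have u: "AE x in lborel. 0 < u x"
        using Pfin by eventually_elim (use P0 in \<open>auto simp: u_def enn2real_positive_iff\<close>)
      have t1: "AE x in lborel. nn_riesz \<alpha> (\<lambda>y. ennreal (u y powr \<delta>)) x \<le> ennreal (C * u x powr (\<delta> - 1 / \<mu>))"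
        using Pfin by eventually_elim (use P0 test[OF b b0 M] in \<open>auto simp: Let_def u_def P_def\<close>)
      \<comment> \<open>The iterated power is kept because Schur's test takes the power
        \<open>r - 1\<close> of the second test function; by \<open>powr_powr\<close> it has
        exponent \<theta>.\<close>
      have t2: "AE x in lborel. nn_riesz \<alpha> (\<lambda>y. ennreal (b y powr r * (u y powr (\<delta> - 1 / \<mu>)) powr (r - 1))) x
          \<le> ennreal (C * (u x powr \<delta>) powr (r - 1))"
        unfolding powr_powr \<theta>_def[symmetric]
        using Pfin by eventually_elim (use P0 test[OF b b0 M] in \<open>auto simp: Let_def u_def P_def\<close>)
      have upos: "AE x in lborel. 0 < u x powr e" for e
        using u by eventually_elim simp
      note S = nn_riesz_schur_test[where w = "\<lambda>x. b x powr r", OF f _ _ _ _ _ r(1) C upos upos t1 t2 fin]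
      show ?thesis
        using S f0 by simp
    qed
  qed
qed

section \<open>Lebesgue measurable functions\<close>

lemma lebesgue_measurable_translation:
  "(\<lambda>y. (x::'a::euclidean_space) + y) \<in> lebesgue \<rightarrow>\<^sub>M lebesgue"
proof (rule measurableI)
  fix A :: "'a set" assume "A \<in> sets lebesgue"
  then have "(\<lambda>y. - x + y) ` A \<in> sets lebesgue" by (rule lebesgue_sets_translation)
  also have "(\<lambda>y. - x + y) ` A = (\<lambda>y. x + y) -` A" by (force simp: image_iff)
  finally show "(\<lambda>y. x + y) -` A \<inter> space lebesgue \<in> sets lebesgue" by simp
qed simp

lemma AE_lborel_translation:
  assumes "AE y in lborel. P (y::'a::euclidean_space)"
  shows "AE y in lborel. P (x + y)"
proof -
  obtain N where N: "N \<in> null_sets lborel" "{y. \<not> P y} \<subseteq> N"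
    using assms by (auto simp: eventually_ae_filter)
  have "{y. y - (- x) \<in> N} \<in> null_sets lborel"
    using N(1) by (rule null_sets_translation)
  moreover have "{y \<in> space lborel. \<not> P (x + y)} \<subseteq> {y. y - (- x) \<in> N}"
    using N(2) by (auto simp: add.commute)
  ultimately show ?thesis by (rule AE_I')
qed

text \<open>Translates of null sets are null sets, so replacing the absolute value of
  \<open>f\<close> by a Borel version changes nothing at any point \<open>x\<close>, not merely at
  almost every one.\<close>

lemma nn_integral_riesz_eq_nn_riesz:
  fixes f g :: "real^'n \<Rightarrow> real"
  assumes [measurable]: "g \<in> borel_measurable borel" and fg: "AE y in lborel. \<bar>f y\<bar> = g y"
  shows "(\<integral>\<^sup>+y. ennreal (norm (f (x + y) / norm y powr (real CARD('n) - \<alpha>))) \<partial>lebesgue)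
           = nn_riesz \<alpha> (\<lambda>y. ennreal (g y)) x"
proof -
  have kernel: "1 / norm y powr (real CARD('n) - \<alpha>) = riesz_kernel \<alpha> y" for y :: "real^'n"
    using powr_minus_divide[of "norm y" "real CARD('n) - \<alpha>"] by (simp add: riesz_kernel_def)
  have "AE y in lborel. \<bar>f (x + y)\<bar> = g (x + y)"
    by (rule AE_lborel_translation[OF fg])
  then have "(\<integral>\<^sup>+y. ennreal (norm (f (x + y) / norm y powr (real CARD('n) - \<alpha>))) \<partial>lebesgue)
      = (\<integral>\<^sup>+y. ennreal (riesz_kernel \<alpha> ((x + y) - x)) * ennreal (g (x + y)) \<partial>lborel)"
    unfolding nn_integral_completion
  proof (intro nn_integral_cong_AE, eventually_elim)
    case (elim y)
    have "norm (f (x + y) / norm y powr (real CARD('n) - \<alpha>)) = riesz_kernel \<alpha> y * \<bar>f (x + y)\<bar>"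
      by (simp add: kernel[symmetric])
    then show ?case using elim by (simp add: ennreal_mult')
  qed
  also have "\<dots> = (\<integral>\<^sup>+y. ennreal (riesz_kernel \<alpha> (y - x)) * ennreal (g y) \<partial>distr lborel borel ((+) x))"
    by (subst nn_integral_distr) simp_all
  also have "\<dots> = nn_riesz \<alpha> (\<lambda>y. ennreal (g y)) x"
    by (simp add: lborel_distr_plus nn_riesz_def)
  finally show ?thesis .
qed

lemma riesz_converges_iff_nn_riesz:
  fixes f g :: "real^'n \<Rightarrow> real"
  assumes f: "f \<in> borel_measurable lebesgue" and g: "g \<in> borel_measurable borel"
    and fg: "AE y in lborel. \<bar>f y\<bar> = g y"
  shows "riesz_converges \<alpha> f x \<longleftrightarrow> nn_riesz \<alpha> (\<lambda>y. ennreal (g y)) x < \<infinity>"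
proof -
  have "(\<lambda>y. f (x + y)) \<in> borel_measurable lebesgue"
    using measurable_compose[OF lebesgue_measurable_translation f] .
  moreover have "(\<lambda>y::real^'n. norm y powr (real CARD('n) - \<alpha>)) \<in> borel_measurable lebesgue"
    by (intro measurable_completion) measurable
  ultimately have "(\<lambda>y. f (x + y) / norm y powr (real CARD('n) - \<alpha>)) \<in> borel_measurable lebesgue"
    by (rule borel_measurable_divide)
  then show ?thesis
    using nn_integral_riesz_eq_nn_riesz[OF g fg, of x \<alpha>]
    by (simp add: riesz_converges_def integrable_iff_bounded)
qed

lemma abs_riesz_potential_le:
  fixes f g :: "real^'n \<Rightarrow> real"
  assumes f: "f \<in> borel_measurable lebesgue" and g: "g \<in> borel_measurable borel"
    and fg: "AE y in lborel. \<bar>f y\<bar> = g y" and fin: "nn_riesz \<alpha> (\<lambda>y. ennreal (g y)) x < \<infinity>"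
  shows "\<bar>riesz_potential \<alpha> f x\<bar> \<le> enn2real (nn_riesz \<alpha> (\<lambda>y. ennreal (g y)) x)"
proof -
  have "integrable lebesgue (\<lambda>y. f (x + y) / norm y powr (real CARD('n) - \<alpha>))"
    using riesz_converges_iff_nn_riesz[OF f g fg] fin by (simp add: riesz_converges_def)
  from integral_norm_bound_ennreal[OF this]
  have "ennreal \<bar>riesz_potential \<alpha> f x\<bar> \<le> nn_riesz \<alpha> (\<lambda>y. ennreal (g y)) x"
    using nn_integral_riesz_eq_nn_riesz[OF g fg, of x \<alpha>] by (simp add: riesz_potential_def)
  then have "enn2real (ennreal \<bar>riesz_potential \<alpha> f x\<bar>) \<le> enn2real (nn_riesz \<alpha> (\<lambda>y. ennreal (g y)) x)"
    using fin by (intro enn2real_mono) auto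
  then show ?thesis by simp
qed

text \<open>The left-hand side of the bound is a \<open>powr\<close>, hence nonnegative; radius 1
  removes the power of \<rho>. This reduces the scaling argument to the cases of zero and positive
  \<open>A\<close>.\<close>

lemma morrey_bound_nonneg:
  assumes "morrey_bound p \<alpha> A b"
  shows "0 \<le> A"
proof -
  obtain X where "X powr (1 / p) \<le> A * 1 powr (- \<alpha>)"
    using assms[unfolded morrey_bound_def, rule_format, of 1 0] by auto
  moreover have "0 \<le> X powr (1 / p)" by simp
  ultimately show ?thesis by (simp only: powr_one_eq_one mult_1_right)
qed

text \<open>The average and the root are undone. The integrability clause of
  \<open>morrey_bound\<close> is what identifies the Bochner integral with the nonnegative
  one.\<close>

lemma morrey_bound_nn_integral:
  fixes b :: "real^'n \<Rightarrow> real"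
  assumes "morrey_bound p \<alpha> A b" and p: "0 < p" and t: "0 < t"
  shows "(\<integral>\<^sup>+y\<in>ball z t. ennreal (b y powr p) \<partial>lborel)
           \<le> ennreal (unit_ball_vol CARD('n) * t powr CARD('n) * (A * t powr (- \<alpha>)) powr p)"
proof -
  define I where "I = (LINT x:ball z t|lebesgue. b x powr p)"
  define V where "V = measure lebesgue (ball z t)"
  have int: "set_integrable lebesgue (ball z t) (\<lambda>x. b x powr p)"
    and le: "(1 / V * I) powr (1 / p) \<le> A * t powr (- \<alpha>)"
    using assms by (auto simp: morrey_bound_def I_def V_def)
  have V: "V = unit_ball_vol CARD('n) * t powr CARD('n)"
    using t by (simp add: V_def content_ball powr_realpow)
  have V0: "0 < V" using t by (simp add: V)
  have I0: "0 \<le> I"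
    unfolding I_def set_lebesgue_integral_def by (intro integral_nonneg_AE) simp
  have "1 / V * I = ((1 / V * I) powr (1 / p)) powr p"
    using p V0 I0 by (simp add: powr_powr)
  also have "\<dots> \<le> (A * t powr (- \<alpha>)) powr p"
    using le p by (intro powr_mono2) auto
  finally have *: "I \<le> V * (A * t powr (- \<alpha>)) powr p"
    using V0 by (simp add: field_simps)
  have "(\<integral>\<^sup>+y\<in>ball z t. ennreal (b y powr p) \<partial>lborel)
      = (\<integral>\<^sup>+y. ennreal (indicator (ball z t) y *\<^sub>R b y powr p) \<partial>lebesgue)"
    unfolding nn_integral_completion by (intro nn_integral_cong) (simp add: indicator_def)
  also have "\<dots> = ennreal I"
    unfolding I_def set_lebesgue_integral_def
    using int[unfolded set_integrable_def] by (intro nn_integral_eq_integral) auto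
  also have "\<dots> \<le> ennreal (V * (A * t powr (- \<alpha>)) powr p)"
    using * by (rule ennreal_leI)
  finally show ?thesis by (simp add: V)
qed

lemma AE_eq_0_if_nn_integral_balls_eq_0:
  fixes g :: "'a::euclidean_space \<Rightarrow> ennreal"
  assumes [measurable]: "g \<in> borel_measurable borel"
    and 0: "\<And>n::nat. (\<integral>\<^sup>+y\<in>ball 0 (Suc n). g y \<partial>lborel) = 0"
  shows "AE y in lborel. g y = 0"
proof -
  have "AE y in lborel. \<forall>n::nat. g y * indicator (ball 0 (Suc n)) y = 0"
    unfolding AE_all_countable
    using 0 by (subst (asm) nn_integral_0_iff_AE)
      (auto intro!: borel_measurable_times_ennreal borel_measurable_indicator)
  then show ?thesis
  proof eventually_elim
    case (elim y)
    obtain n where "norm y < real n" using reals_Archimedean2 by blast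
    then show ?case using elim[rule_format, of n] by simp
  qed
qed

section \<open>Reduction to the normalised Borel case\<close>

theorem theorem1:
  fixes \<alpha> r p :: real
  assumes "0 < \<alpha>" and "\<alpha> < real CARD('n::finite)" and "\<alpha> \<le> r"
    and "1 < r" and "r < p" and "p \<le> real CARD('n)"
  shows "\<exists>N::real. \<forall>(A::real) (b :: real^'n \<Rightarrow> real).
           b \<in> borel_measurable lebesgue \<longrightarrow> (\<forall>x. 0 \<le> b x) \<longrightarrow> morrey_bound p \<alpha> A b \<longrightarrow>
           (\<forall>f \<in> L_fun r.
              (AE x in lebesgue. b x \<noteq> 0 \<longrightarrow> riesz_converges \<alpha> f x) \<and>
              (\<integral>\<^sup>+ x. ennreal (b x powr r * \<bar>riesz_potential \<alpha> f x\<bar> powr r) \<partial>lebesgue)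
                \<le> ennreal (N * A powr r * (LINT x|lebesgue. \<bar>f x\<bar> powr r)))"
proof -
  have p: "0 < p" using assms by auto
  obtain C where C: "0 < C" and trace: "\<And>b f :: real^'n \<Rightarrow> real.
     b \<in> borel_measurable borel \<Longrightarrow> (\<forall>y. 0 \<le> b y) \<Longrightarrow>
     (\<forall>t>0. \<forall>z. (\<integral>\<^sup>+y\<in>ball z t. ennreal (b y powr p) \<partial>lborel)
         \<le> ennreal (unit_ball_vol CARD('n) * t powr (CARD('n) - \<alpha> * p))) \<Longrightarrow>
     f \<in> borel_measurable borel \<Longrightarrow> (\<forall>y. 0 \<le> f y) \<Longrightarrow>
     (\<integral>\<^sup>+x. ennreal (f x powr r) \<partial>lborel) < \<infinity> \<Longrightarrow>
     (AE x in lborel. b x \<noteq> 0 \<longrightarrow> nn_riesz \<alpha> (\<lambda>y. ennreal (f y)) x < \<infinity>) \<and>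
     (\<integral>\<^sup>+x. ennreal (b x powr r * enn2real (nn_riesz \<alpha> (\<lambda>y. ennreal (f y)) x) powr r) \<partial>lborel)
       \<le> ennreal C * (\<integral>\<^sup>+x. ennreal (f x powr r) \<partial>lborel)"
    using nn_riesz_trace_inequality[where 'a = "real^'n", of \<alpha> r p] assms by auto
  show ?thesis
  \<comment> \<open>The constant of the trace inequality serves as \<open>N\<close>; it is fixed
    before \<open>A\<close>, \<open>b\<close> and \<open>f\<close>.\<close>
  proof (intro exI[of _ C] allI impI ballI)
    fix A :: real and b f :: "real^'n \<Rightarrow> real"
    assume b: "b \<in> borel_measurable lebesgue" and b0: "\<forall>x. 0 \<le> b x"
      and M: "morrey_bound p \<alpha> A b" and "f \<in> L_fun r"
    then have f: "f \<in> borel_measurable lebesgue" and f_int: "integrable lebesgue (\<lambda>x. \<bar>f x\<bar> powr r)"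
      by (auto simp: L_fun_def)
    obtain b' where b': "b' \<in> borel_measurable lborel" "AE x in lborel. b x = b' x"
      using completion_ex_borel_measurable_real[OF b] by blast
    obtain f' where f': "f' \<in> borel_measurable lborel" "AE x in lborel. f x = f' x"
      using completion_ex_borel_measurable_real[OF f] by blast
    define g where "g x = \<bar>f' x\<bar>" for x
    have g: "g \<in> borel_measurable borel" using f'(1) unfolding g_def[abs_def] by measurable
    have fg: "AE x in lborel. \<bar>f x\<bar> = g x" using f'(2) by eventually_elim (simp add: g_def)
    define J where "J = (LINT x|lebesgue. \<bar>f x\<bar> powr r)"
    have J: "(\<integral>\<^sup>+x. ennreal (g x powr r) \<partial>lborel) = ennreal J"
    proof -
      have "(\<integral>\<^sup>+x. ennreal (g x powr r) \<partial>lborel) = (\<integral>\<^sup>+x. ennreal (\<bar>f x\<bar> powr r) \<partial>lebesgue)"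
        unfolding nn_integral_completion
        by (intro nn_integral_cong_AE) (use fg in eventually_elim, simp)
      also have "\<dots> = ennreal J"
        unfolding J_def by (intro nn_integral_eq_integral f_int) simp
      finally show ?thesis .
    qed
    have J0: "0 \<le> J" unfolding J_def by (intro integral_nonneg_AE) simp
    define R where "R = nn_riesz \<alpha> (\<lambda>y. ennreal (g y))"
    have conv: "riesz_converges \<alpha> f x \<longleftrightarrow> R x < \<infinity>" for x
      unfolding R_def by (rule riesz_converges_iff_nn_riesz[OF f g fg])
    show "(AE x in lebesgue. b x \<noteq> 0 \<longrightarrow> riesz_converges \<alpha> f x) \<and>
        (\<integral>\<^sup>+ x. ennreal (b x powr r * \<bar>riesz_potential \<alpha> f x\<bar> powr r) \<partial>lebesgue)
          \<le> ennreal (C * A powr r * (LINT x|lebesgue. \<bar>f x\<bar> powr r))"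
    proof (cases "A = 0")
      case True
      \<comment> \<open>The Borel version may be negative on a null set; the absolute value repairs
        this. With \<open>A = 0\<close> the Morrey bound makes the integral of
        \<open>b powr p\<close> over each ball vanish.\<close>
      define h where "h x = \<bar>b' x\<bar>" for x
      have h: "h \<in> borel_measurable borel" using b'(1) unfolding h_def[abs_def] by measurable
      have bh: "AE x in lborel. b x = h x"
        using b'(2)
      proof eventually_elim
        case (elim x)
        then show ?case using b0[rule_format, of x] by (simp add: h_def)
      qed
      have "AE y in lborel. ennreal (h y powr p) = 0"
      proof (rule AE_eq_0_if_nn_integral_balls_eq_0)
        fix n :: nat
        have "(\<integral>\<^sup>+y\<in>ball 0 (Suc n). ennreal (h y powr p) \<partial>lborel)
            = (\<integral>\<^sup>+y\<in>ball 0 (Suc n). ennreal (b y powr p) \<partial>lborel)"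
          by (intro nn_integral_cong_AE) (use bh in eventually_elim, simp)
        also have "\<dots> \<le> 0"
          using morrey_bound_nn_integral[OF M p, of "Suc n" 0] True by simp
        finally show "(\<integral>\<^sup>+y\<in>ball 0 (Suc n). ennreal (h y powr p) \<partial>lborel) = 0" by simp
      qed (use h in measurable)
      with bh have b_0: "AE x in lborel. b x = 0"
        by eventually_elim (auto simp: ennreal_eq_0_iff)
      then have "(\<integral>\<^sup>+ x. ennreal (b x powr r * \<bar>riesz_potential \<alpha> f x\<bar> powr r) \<partial>lborel) = (\<integral>\<^sup>+x. 0 \<partial>(lborel :: (real^'n) measure))"
        by (intro nn_integral_cong_AE, eventually_elim) simp
      moreover have "AE x in lborel. b x \<noteq> 0 \<longrightarrow> riesz_converges \<alpha> f x"
        using b_0 by eventually_elim simp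
      ultimately show ?thesis
        by (simp add: nn_integral_completion AE_completion_iff)
    next
      case False
      then have A: "0 < A" using morrey_bound_nonneg[OF M] by simp
      define h where "h x = \<bar>b' x\<bar> / A" for x
      have h: "h \<in> borel_measurable borel" using b'(1) unfolding h_def[abs_def] by measurable
      have h0: "\<forall>x. 0 \<le> h x" using A by (simp add: h_def)
      have bh: "AE x in lborel. b x = A * h x"
        using b'(2)
      proof eventually_elim
        case (elim x)
        then show ?case using b0[rule_format, of x] A by (simp add: h_def)
      qed
      \<comment> \<open>The factor \<open>A powr (- p)\<close> from the scaling cancels
        \<open>A powr p\<close>, and the power \<open>p\<close> of
        \<open>t powr (- \<alpha>)\<close> lowers the exponent \<open>d\<close> of the ball volume
        to \<open>d - \<alpha> * p\<close>.\<close>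
      have hM: "\<forall>t>0. \<forall>z. (\<integral>\<^sup>+y\<in>ball z t. ennreal (h y powr p) \<partial>lborel)
         \<le> ennreal (unit_ball_vol CARD('n) * t powr (CARD('n) - \<alpha> * p))"
      proof (intro allI impI)
        fix t :: real and z :: "real^'n" assume t: "0 < t"
        define W where "W = unit_ball_vol CARD('n) * t powr CARD('n) * (A * t powr (- \<alpha>)) powr p"
        have "(\<integral>\<^sup>+y\<in>ball z t. ennreal (h y powr p) \<partial>lborel)
            = (\<integral>\<^sup>+y. ennreal (A powr (- p)) * (ennreal ((A * h y) powr p) * indicator (ball z t) y) \<partial>lborel)"
        proof (intro nn_integral_cong)
          fix y
          have "h y powr p = A powr (- p) * (A * h y) powr p"
            using A h0 by (simp add: powr_mult powr_minus)
          then show "ennreal (h y powr p) * indicator (ball z t) y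
              = ennreal (A powr (- p)) * (ennreal ((A * h y) powr p) * indicator (ball z t) y)"
            by (simp add: ennreal_mult mult_ac)
        qed
        also have "\<dots> = ennreal (A powr (- p)) * (\<integral>\<^sup>+y\<in>ball z t. ennreal ((A * h y) powr p) \<partial>lborel)"
          using h by (intro nn_integral_cmult borel_measurable_times_ennreal borel_measurable_indicator) auto
        also have "(\<integral>\<^sup>+y\<in>ball z t. ennreal ((A * h y) powr p) \<partial>lborel)
            = (\<integral>\<^sup>+y\<in>ball z t. ennreal (b y powr p) \<partial>lborel)"
          by (intro nn_integral_cong_AE) (use bh in eventually_elim, simp)
        also have "ennreal (A powr (- p)) * \<dots> \<le> ennreal (A powr (- p)) * ennreal W"
          unfolding W_def
          by (intro mult_left_mono morrey_bound_nn_integral[OF M p t]) auto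
        also have "\<dots> = ennreal (A powr (- p) * W)"
          by (simp add: W_def ennreal_mult)
        also have "A powr (- p) * W = unit_ball_vol CARD('n) * t powr (CARD('n) - \<alpha> * p)"
        proof -
          have "(A * t powr (- \<alpha>)) powr p = A powr p * t powr (- (\<alpha> * p))"
            using A by (simp add: powr_mult powr_powr)
          then show ?thesis
            using A by (simp add: W_def powr_minus powr_diff field_simps)
        qed
        finally show "(\<integral>\<^sup>+y\<in>ball z t. ennreal (h y powr p) \<partial>lborel)
           \<le> ennreal (unit_ball_vol CARD('n) * t powr (CARD('n) - \<alpha> * p))" .
      qed
      have g0: "\<forall>y. 0 \<le> g y" by (simp add: g_def)
      have "(\<integral>\<^sup>+x. ennreal (g x powr r) \<partial>lborel) < \<infinity>" by (simp add: J)
      from trace[OF h h0 hM g g0 this]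
      have fin: "AE x in lborel. h x \<noteq> 0 \<longrightarrow> R x < \<infinity>"
        and bound: "(\<integral>\<^sup>+x. ennreal (h x powr r * enn2real (R x) powr r) \<partial>lborel) \<le> ennreal C * ennreal J"
        by (auto simp: R_def J)
      have c: "AE x in lborel. b x \<noteq> 0 \<longrightarrow> riesz_converges \<alpha> f x"
        using fin bh by eventually_elim (auto simp: conv)
      have "(\<integral>\<^sup>+ x. ennreal (b x powr r * \<bar>riesz_potential \<alpha> f x\<bar> powr r) \<partial>lborel)
          \<le> (\<integral>\<^sup>+ x. ennreal (A powr r) * ennreal (h x powr r * enn2real (R x) powr r) \<partial>lborel)"
        using fin bh
      proof (intro nn_integral_mono_AE, eventually_elim)
        case (elim x)
        \<comment> \<open>Where \<open>h\<close> vanishes, so does \<open>b\<close>, and both sides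
          are 0. Elsewhere \<open>R\<close> is finite and dominates the absolute value of the
          potential.\<close>
        show ?case
        proof (cases "h x = 0")
          case False
          have "\<bar>riesz_potential \<alpha> f x\<bar> powr r \<le> enn2real (R x) powr r"
            using abs_riesz_potential_le[OF f g fg] elim False assms
            by (intro powr_mono2) (auto simp: R_def)
          then have "b x powr r * \<bar>riesz_potential \<alpha> f x\<bar> powr r \<le> b x powr r * enn2real (R x) powr r"
            by (intro mult_left_mono) auto
          also have "\<dots> = A powr r * (h x powr r * enn2real (R x) powr r)"
            using elim A h0 by (simp add: powr_mult)
          finally show ?thesis
            by (simp add: ennreal_leI flip: ennreal_mult)
        qed (use elim in simp)
      qed
      also have "\<dots> = ennreal (A powr r) * (\<integral>\<^sup>+ x. ennreal (h x powr r * enn2real (R x) powr r) \<partial>lborel)"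
      proof -
        note [measurable] = h g
        show ?thesis unfolding R_def by (intro nn_integral_cmult) measurable
      qed
      also have "\<dots> \<le> ennreal (A powr r) * (ennreal C * ennreal J)"
        by (intro mult_left_mono bound) auto
      also have "\<dots> = ennreal (C * A powr r * J)"
        using C J0 by (simp add: mult_ac flip: ennreal_mult)
      finally show ?thesis
        using c by (simp add: nn_integral_completion AE_completion_iff J_def)
    qed
  qed
qed

end
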